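(* Let $R:\mathbb{R}^n\to\mathbb{Z}^n$ be a quantizer and suppose the nonsingular matrix $L\in\mathbb{R}^{n\times n}$ of the quantized linear $(R,L)$-system, with transition operator $T=R\circ L:\mathbb{Z}^n\to\mathbb{Z}^n$, is iteratively nonresonant. Then: (a) the associated algebra $\mathcal{Q}$ consists of frequency measurable subsets of the lattice $\mathbb{Z}^n$; (b) the backward and forward algebras $\mathcal{Q}^-$ and $\mathcal{Q}^+$ are independent in the sense that $\mathbf{F}(A\cap B)=\mathbf{F}(A)\mathbf{F}(B)$ for all $A\in\mathcal{Q}^-$, $B\in\mathcal{Q}^+$; (c) the transition operator $T$ preserves the frequency $\mathbf{F}$ on the forward algebra: $\mathbf{F}(T^{-1}(A))=\mathbf{F}(A)$ for all $A\in\mathcal{Q}^+$.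
   Context: Frequency. For $a\in\mathbb{Z}^n$ and $\ell\in\mathbb{N}^n$ let $P_{a,\ell}=\{x\in\mathbb{Z}^n:\ a_k\le x_k<a_k+\ell_k \text{ for all }1\le k\le n\}$, and for $N\in\mathbb{N}$ let $\mathcal{P}_N=\{P_{a,\ell}:\ a\in\mathbb{Z}^n,\ \ell\in\mathbb{N}^n,\ \min_k\ell_k\ge N\}$. For $A\subset\mathbb{Z}^n$ put $\mathbf{F}_*(A)=\sup_{N\ge1}\inf_{P\in\mathcal{P}_N}\frac{\#(A\cap P)}{\#P}$ and $\mathbf{F}^*(A)=\inf_{N\ge1}\sup_{P\in\mathcal{P}_N}\frac{\#(A\cap P)}{\#P}$. The set $A$ is frequency measurable if $\mathbf{F}_*(A)=\mathbf{F}^*(A)$; the common value is the frequency $\mathbf{F}(A)$. System. A quantizer is a map $R:\mathbb{R}^n\to\mathbb{Z}^n$ such that $R(u+z)=R(u)+z$ for all $u\in\mathbb{R}^n$, $z\in\mathbb{Z}^n$, and the set $R^{-1}(0)$ is Jordan measurable (bounded with boundary of zero Lebesgue measure). Algebras. For $m\in\mathbb{N}$, $G\subset\mathbb{R}^m$ and $\Lambda\in\mathbb{R}^{m\times n}$ let $Q_m(G,\Lambda)=\{x\in\mathbb{Z}^n:\ \Lambda x\in G+\mathbb{Z}^m\}$ and $\mathcal{Q}_m(\Lambda)=\{Q_m(G,\Lambda):\ G\subset[0,1)^m\text{ Jordan measurable}\}$. For a matrix $\mathcal{M}$ with $n$ columns and countably infinitely many rows, $\mathcal{Q}_\infty(\mathcal{M})$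 is the union of $\mathcal{Q}_m(\Lambda)$ over all $m\in\mathbb{N}$ and all $m\times n$ submatrices $\Lambda$ of $\mathcal{M}$ (formed from $m$ rows with distinct indices). Let $\mathcal{L}^-$ be obtained by stacking the powers $\ldots,L^{-2},L^{-1}$, $\mathcal{L}^+$ by stacking $L,L^2,\ldots$, and $\mathcal{L}=\begin{bmatrix}\mathcal{L}^-\\ \mathcal{L}^+\end{bmatrix}$. Then $\mathcal{Q}=\mathcal{Q}_\infty(\mathcal{L})$ (associated algebra), $\mathcal{Q}^-=\mathcal{Q}_\infty(\mathcal{L}^-)$ (backward algebra), $\mathcal{Q}^+=\mathcal{Q}_\infty(\mathcal{L}^+)$ (forward algebra). Nonresonance. $\Lambda\in\mathbb{R}^{m\times n}$ is nonresonant if the rows of $\begin{bmatrix}I_n\\ \Lambda\end{bmatrix}$ are linearly independent over the rationals. A nonsingular $L$ is iteratively nonresonant if, for every $m\in\mathbb{N}$, every $m\times n$ submatrix of $\mathcal{L}$ is nonresonant. *)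

theory Defs
  imports "HOL-Analysis.Analysis"
begin

definition of_int_vec :: "int ^ 'n \<Rightarrow> real ^ 'n" where
  "of_int_vec x = (\<chi> k. real_of_int (x $ k))"

section \<open>Frequency\<close>

definition box_int :: "int ^ 'n \<Rightarrow> nat ^ 'n \<Rightarrow> (int ^ 'n) set" where
  "box_int a l = {x. \<forall>k. a $ k \<le> x $ k \<and> x $ k < a $ k + int (l $ k)}"

definition boxes_ge :: "nat \<Rightarrow> (int ^ 'n) set set" where
  "boxes_ge N = {box_int a l | a l. \<forall>k. N \<le> l $ k}"

definition density_in :: "(int ^ 'n) set \<Rightarrow> (int ^ 'n) set \<Rightarrow> real" where
  "density_in A P = real (card (A \<inter> P)) / real (card P)"

(* For N \<ge> 1 the boxes are finite and nonempty, so all suprema and infima below are taken over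
   nonempty sets of reals in [0, 1]. *)
definition lower_freq :: "(int ^ 'n) set \<Rightarrow> real" where
  "lower_freq A = (SUP N\<in>{1..}. INF P\<in>boxes_ge N. density_in A P)"

definition upper_freq :: "(int ^ 'n) set \<Rightarrow> real" where
  "upper_freq A = (INF N\<in>{1..}. SUP P\<in>boxes_ge N. density_in A P)"

definition freq_measurable :: "(int ^ 'n) set \<Rightarrow> bool" where
  "freq_measurable A \<longleftrightarrow> lower_freq A = upper_freq A"

(* Meaningful only for frequency measurable A, where it is the common value of both frequencies. *)
definition freq :: "(int ^ 'n) set \<Rightarrow> real" where
  "freq A = lower_freq A"

section \<open>Quantized linear systems\<close>

definition jordan_measurable :: "'a::euclidean_space set \<Rightarrow> bool" where
  "jordan_measurable S \<longleftrightarrow> bounded S \<and> frontier S \<in> null_sets lborel"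

definition quantizer :: "(real ^ 'n \<Rightarrow> int ^ 'n) \<Rightarrow> bool" where
  "quantizer R \<longleftrightarrow>
     (\<forall>u z. R (u + of_int_vec z) = R u + z) \<and> jordan_measurable (R -` {0})"

definition transition :: "(real ^ 'n \<Rightarrow> int ^ 'n) \<Rightarrow> real ^ 'n ^ 'n \<Rightarrow> int ^ 'n \<Rightarrow> int ^ 'n" where
  "transition R L x = R (L *v of_int_vec x)"

section \<open>Quasiperiodic sets\<close>

text \<open>
  Since the number \<open>m\<close> of rows is existentially quantified in the algebras below, \<open>\<real>\<^sup>m\<close> cannot be
  the type \<open>real ^ 'm\<close>. It is represented by the extensional functions on \<open>{..<m}\<close>, with the product
  topology and the product of the Lebesgue-Borel measures. An \<open>m \<times> n\<close> matrix is the family of its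
  rows, of which only those with index below \<open>m\<close> matter.
\<close>

definition jordan_measurable_dim :: "nat \<Rightarrow> (nat \<Rightarrow> real) set \<Rightarrow> bool" where
  "jordan_measurable_dim m G \<longleftrightarrow>
     G \<subseteq> (\<Pi>\<^sub>E i\<in>{..<m}. UNIV) \<and>
     (\<exists>C. \<forall>g\<in>G. \<forall>i<m. \<bar>g i\<bar> \<le> C) \<and>
     (product_topology (\<lambda>i. euclideanreal) {..<m}) frontier_of G
       \<in> null_sets (PiM {..<m} (\<lambda>i. lborel))"

(* Only meaningful for G \<subseteq> (\<Pi>\<^sub>E i\<in>{..<m}. UNIV). *)
definition Q_set :: "nat \<Rightarrow> (nat \<Rightarrow> real) set \<Rightarrow> (nat \<Rightarrow> real ^ 'n) \<Rightarrow> (int ^ 'n) set" where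
  "Q_set m G \<Lambda> =
     {x. \<exists>g\<in>G. \<exists>z :: nat \<Rightarrow> int. \<forall>i<m. \<Lambda> i \<bullet> of_int_vec x = g i + real_of_int (z i)}"

definition Q_fin :: "nat \<Rightarrow> (nat \<Rightarrow> real ^ 'n) \<Rightarrow> (int ^ 'n) set set" where
  "Q_fin m \<Lambda> =
     {Q_set m G \<Lambda> | G. G \<subseteq> (\<Pi>\<^sub>E i\<in>{..<m}. {0..<1}) \<and> jordan_measurable_dim m G}"

text \<open>
  A matrix with infinitely many rows is a family \<open>M\<close> of rows together with the set \<open>K\<close> of its row
  indices; its submatrices with \<open>m\<close> rows are the \<open>M \<circ> \<sigma>\<close> for selections \<open>\<sigma>\<close> of \<open>m\<close> distinct indices.
\<close>

definition row_selection :: "'k set \<Rightarrow> nat \<Rightarrow> (nat \<Rightarrow> 'k) \<Rightarrow> bool" where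
  "row_selection K m \<sigma> \<longleftrightarrow> inj_on \<sigma> {..<m} \<and> \<sigma> ` {..<m} \<subseteq> K"

definition Q_inf :: "'k set \<Rightarrow> ('k \<Rightarrow> real ^ 'n) \<Rightarrow> (int ^ 'n) set set" where
  "Q_inf K M = \<Union>{Q_fin m (M \<circ> \<sigma>) | m \<sigma>. 1 \<le> m \<and> row_selection K m \<sigma>}"

definition mat_powi :: "real ^ 'n ^ 'n \<Rightarrow> int \<Rightarrow> real ^ 'n ^ 'n" where
  "mat_powi L k =
     (if 0 \<le> k then (((**) L) ^^ nat k) (mat 1)
      else (((**) (matrix_inv L)) ^^ nat (- k)) (mat 1))"

(* The row indexed by (k, j) is the j-th row of the block L^k. *)
definition stacked_powers :: "real ^ 'n ^ 'n \<Rightarrow> int \<times> 'n \<Rightarrow> real ^ 'n" where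
  "stacked_powers L = (\<lambda>(k, j). row j (mat_powi L k))"

definition rows_all :: "(int \<times> 'n) set" where
  "rows_all = {(k, j). k \<noteq> 0}"

definition rows_backward :: "(int \<times> 'n) set" where
  "rows_backward = {(k, j). k < 0}"

definition rows_forward :: "(int \<times> 'n) set" where
  "rows_forward = {(k, j). 0 < k}"

definition associated_algebra :: "real ^ 'n ^ 'n \<Rightarrow> (int ^ 'n) set set" where
  "associated_algebra L = Q_inf rows_all (stacked_powers L)"

definition backward_algebra :: "real ^ 'n ^ 'n \<Rightarrow> (int ^ 'n) set set" where
  "backward_algebra L = Q_inf rows_backward (stacked_powers L)"

definition forward_algebra :: "real ^ 'n ^ 'n \<Rightarrow> (int ^ 'n) set set" where
  "forward_algebra L = Q_inf rows_forward (stacked_powers L)"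

section \<open>Nonresonance\<close>

(* Independence of an indexed family, so that a repeated row counts as a dependence. *)
definition rat_lin_indep :: "'i set \<Rightarrow> ('i \<Rightarrow> real ^ 'n) \<Rightarrow> bool" where
  "rat_lin_indep I v \<longleftrightarrow>
     (\<forall>c :: 'i \<Rightarrow> rat. (\<Sum>i\<in>I. real_of_rat (c i) *\<^sub>R v i) = 0 \<longrightarrow> (\<forall>i\<in>I. c i = 0))"

(* The family indexed by the disjoint sum consists of the rows of the identity matrix followed
   by the m rows of \<Lambda>. *)
definition nonresonant :: "nat \<Rightarrow> (nat \<Rightarrow> real ^ 'n) \<Rightarrow> bool" where
  "nonresonant m \<Lambda> \<longleftrightarrow>
     rat_lin_indep ((UNIV :: 'n set) <+> {..<m}) (case_sum (\<lambda>j. row j (mat 1)) \<Lambda>)"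

definition iteratively_nonresonant :: "real ^ 'n ^ 'n \<Rightarrow> bool" where
  "iteratively_nonresonant L \<longleftrightarrow>
     (\<forall>m \<sigma>. 1 \<le> m \<longrightarrow> row_selection rows_all m \<sigma> \<longrightarrow> nonresonant m (stacked_powers L \<circ> \<sigma>))"

end

theory Submission
  imports Defs
begin

text \<open>
  The density of a set in large boxes is the uniform mean of its indicator function. The character
  \<open>x \<mapsto> exp (2 \<pi> i \<theta> \<bullet> x)\<close> has mean 1 or 0 according to whether \<open>\<theta>\<close> is integral, since sums over boxes
  factor into geometric sums. Under nonresonance a trigonometric polynomial on the torus, evaluated
  along the orbit \<open>\<Lambda> x\<close>, therefore has its integral as mean. By the Stone-Weierstrass theorem a bounded
  function on the torus whose discontinuities lie in a compact null set is, up to a trigonometric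
  majorant of small mean, a trigonometric polynomial along the orbit. This gives (a). For (b), the
  frequencies occurring for the two algebras are independent over the integers, so means of products
  of trigonometric polynomials multiply. For (c) it suffices that composition with \<open>T\<close> preserves the
  means of characters. The volume of the sets \<open>G\<close> never enters.
\<close>

section \<open>Uniform means over boxes\<close>

text \<open>Two functions with jumps have to be averaged: the indicator of a set \<open>G\<close>
  modulo 1, and the character of the quantization error \<open>R u - u\<close>. Both descend to a
  torus and are discontinuous only over a compact null set, so one lemma,
  \<open>trig_approximable_orbit\<close>, stated for finite index sets in general, serves both. It
  yields only the existence of means, through completeness of the complex plane; (b) and (c) then
  compare means whose values stay unknown, and this is why no volume is computed. The map
  \<open>T\<close> is nonlinear, but only characters have to be composed with it, and there the
  rounding splits off as a factor. Multiplying a row vector by \<open>L\<close> moves a row of the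
  block \<open>L^k\<close> to the block \<open>L^(k+1)\<close>. A nonintegral forward frequency thus
  stays nonintegral, whereas a row of \<open>L^(-1)\<close> would become a row of the identity,
  hence integral: this ties (c) to the forward algebra.\<close>

definition box_filter :: "(int ^ 'n) set filter" where
  "box_filter = (INF N. principal (boxes_ge N))"

lemma boxes_ge_antimono: "N \<le> N' \<Longrightarrow> boxes_ge N' \<subseteq> boxes_ge N"
  unfolding boxes_ge_def using order_trans by blast

lemma boxes_ge_nonempty: "boxes_ge N \<noteq> {}"
proof -
  have "box_int 0 (\<chi> k. N) \<in> boxes_ge N"
    unfolding boxes_ge_def by force
  then show ?thesis by blast
qed

lemma eventually_box_filter:
  "eventually Q box_filter \<longleftrightarrow> (\<exists>N. \<forall>P\<in>boxes_ge N. Q P)"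
  unfolding box_filter_def
proof (subst eventually_INF_base)
  fix a b :: nat
  show "\<exists>x\<in>UNIV. principal (boxes_ge x) \<le> inf (principal (boxes_ge a :: (int ^ 'n) set set)) (principal (boxes_ge b))"
    by (rule bexI[of _ "max a b"]) (auto intro: boxes_ge_antimono[THEN subsetD, rotated])
qed (auto simp: eventually_principal)

lemma box_filter_neq_bot [simp]: "box_filter \<noteq> bot"
  unfolding trivial_limit_def eventually_box_filter using boxes_ge_nonempty by blast

text \<open>The families \<open>boxes_ge N\<close> decrease in \<open>N\<close>, so each of them
  contains boxes from far out in the filter; hence every infimum \<open>l N\<close> is at most
  \<open>c\<close> and every supremum \<open>u N\<close> at least \<open>c\<close>. For large
  \<open>N\<close> all densities are close to \<open>c\<close>, which gives the reverse
  bounds.\<close>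

lemma freq_eqI:
  assumes "(density_in A \<longlongrightarrow> c) box_filter"
  shows "freq_measurable A" "freq A = c"
proof -
  have d01: "0 \<le> density_in A P" "density_in A P \<le> 1" for P :: "(int ^ 'a) set"
  proof -
    show "0 \<le> density_in A P" by (simp add: density_in_def)
    show "density_in A P \<le> 1"
    proof (cases "finite P")
      case True
      then show ?thesis by (simp add: density_in_def divide_le_eq card_mono)
    qed (simp add: density_in_def)
  qed
  have bb: "bdd_below (density_in A ` boxes_ge N)" "bdd_above (density_in A ` boxes_ge N)" for N
    using d01 by (auto intro!: bdd_belowI[of _ 0] bdd_aboveI[of _ 1])
  define l where "l N = (INF P\<in>boxes_ge N. density_in A P)" for N
  define u where "u N = (SUP P\<in>boxes_ge N. density_in A P)" for N
  have near: "\<exists>N\<ge>1. \<forall>P\<in>boxes_ge N. \<bar>density_in A P - c\<bar> < e" if "e > 0" for e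
  proof -
    obtain N where "\<forall>P\<in>boxes_ge N. \<bar>density_in A P - c\<bar> < e"
      using tendstoD[OF assms \<open>e > 0\<close>] unfolding eventually_box_filter dist_real_def by blast
    \<comment> \<open>Both frequencies range over \<open>N >= 1\<close>, hence
      \<open>max N 1\<close>.\<close>
    then show ?thesis using boxes_ge_antimono[of N "max N 1"] by (intro exI[of _ "max N 1"]) auto
  qed
  have near2: "\<exists>P\<in>boxes_ge N. \<bar>density_in A P - c\<bar> < e" if "e > 0" for e N
  proof -
    obtain N' where N': "\<forall>P\<in>boxes_ge N'. \<bar>density_in A P - c\<bar> < e" using near[OF \<open>e > 0\<close>] by blast
    obtain P :: "(int ^ 'a) set" where P: "P \<in> boxes_ge (max N N')" using boxes_ge_nonempty by blast
    have "P \<in> boxes_ge N" using boxes_ge_antimono[of N "max N N'"] P by auto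
    moreover have "P \<in> boxes_ge N'" using boxes_ge_antimono[of N' "max N N'"] P by auto
    ultimately show ?thesis using N' by blast
  qed
  have lc: "l N \<le> c" for N
  proof (rule field_le_epsilon)
    fix e :: real assume "e > 0"
    then obtain P where P: "P \<in> boxes_ge N" "\<bar>density_in A P - c\<bar> < e" using near2 by blast
    have "l N \<le> density_in A P" unfolding l_def using bb P by (intro cINF_lower)
    then show "l N \<le> c + e" using P by linarith
  qed
  have uc: "c \<le> u N" for N
  proof (rule field_le_epsilon)
    fix e :: real assume "e > 0"
    then obtain P where P: "P \<in> boxes_ge N" "\<bar>density_in A P - c\<bar> < e" using near2 by blast
    have "density_in A P \<le> u N" unfolding u_def using bb P by (intro cSUP_upper)
    then show "c \<le> u N + e" using P by linarith
  qed
  have bl: "bdd_above (l ` {1..})" and bu: "bdd_below (u ` {1..})"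
    using lc uc by (auto intro!: bdd_aboveI[of _ c] bdd_belowI[of _ c])
  have "lower_freq A = c"
  proof (rule antisym)
    show "lower_freq A \<le> c"
      unfolding lower_freq_def l_def[symmetric] using lc by (intro cSUP_least) auto
    show "c \<le> lower_freq A"
    proof (rule field_le_epsilon)
      fix e :: real assume "e > 0"
      then obtain N where N: "N \<ge> 1" "\<forall>P\<in>boxes_ge N. \<bar>density_in A P - c\<bar> < e" using near by blast
      have "c - e \<le> l N" unfolding l_def
        using N(2) by (intro cINF_greatest boxes_ge_nonempty) (auto simp: abs_less_iff less_imp_le algebra_simps)
      also have "l N \<le> lower_freq A"
        unfolding lower_freq_def l_def[symmetric] using N(1) bl by (intro cSUP_upper) auto
      finally show "c \<le> lower_freq A + e" by simp
    qed
  qed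
  moreover have "upper_freq A = c"
  proof (rule antisym)
    show "c \<le> upper_freq A"
      unfolding upper_freq_def u_def[symmetric] using uc by (intro cINF_greatest) auto
    show "upper_freq A \<le> c"
    proof (rule field_le_epsilon)
      fix e :: real assume "e > 0"
      then obtain N where N: "N \<ge> 1" "\<forall>P\<in>boxes_ge N. \<bar>density_in A P - c\<bar> < e" using near by blast
      have "upper_freq A \<le> u N"
        unfolding upper_freq_def u_def[symmetric] using N(1) bu by (intro cINF_lower) auto
      also have "u N \<le> c + e" unfolding u_def
        using N(2) by (intro cSUP_least boxes_ge_nonempty) (auto simp: abs_less_iff less_imp_le algebra_simps)
      finally show "upper_freq A \<le> c + e" .
    qed
  qed
  ultimately show "freq_measurable A" "freq A = c"
    by (auto simp: freq_measurable_def freq_def)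
qed

section \<open>Means of complex functions along the box filter\<close>

definition avg :: "(int ^ 'n \<Rightarrow> complex) \<Rightarrow> (int ^ 'n) set \<Rightarrow> complex" where
  "avg f P = (\<Sum>x\<in>P. f x) / of_nat (card P)"

definition has_mean :: "(int ^ 'n \<Rightarrow> complex) \<Rightarrow> complex \<Rightarrow> bool" where
  "has_mean f c \<longleftrightarrow> (avg f \<longlongrightarrow> c) box_filter"

lemma avg_add: "avg (\<lambda>x. f x + g x) P = avg f P + avg g P"
  by (simp add: avg_def sum.distrib add_divide_distrib)

lemma avg_diff: "avg (\<lambda>x. f x - g x) P = avg f P - avg g P"
  by (simp add: avg_def sum_subtractf diff_divide_distrib)

lemma avg_cmult: "avg (\<lambda>x. c * f x) P = c * avg f P"
  by (simp add: avg_def sum_distrib_left)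

text \<open>The majorant \<open>q\<close> is complex, with only its real part used, so that it may
  itself be a trigonometric polynomial.\<close>

lemma norm_avg_le:
  assumes "\<And>x. cmod (f x) \<le> Re (q x)"
  shows "cmod (avg f P) \<le> Re (avg q P)"
proof -
  have "cmod (\<Sum>x\<in>P. f x) \<le> Re (\<Sum>x\<in>P. q x)"
    unfolding Re_sum by (intro sum_norm_le assms)
  then show ?thesis
    unfolding avg_def by (simp add: norm_divide divide_right_mono Re_divide_of_nat)
qed

lemma has_mean_add: "has_mean f a \<Longrightarrow> has_mean g b \<Longrightarrow> has_mean (\<lambda>x. f x + g x) (a + b)"
  unfolding has_mean_def avg_add[abs_def] by (rule tendsto_add)

lemma has_mean_cmult: "has_mean f a \<Longrightarrow> has_mean (\<lambda>x. c * f x) (c * a)"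
  unfolding has_mean_def avg_cmult[abs_def] by (intro tendsto_intros)

lemma has_mean_unique: "has_mean f a \<Longrightarrow> has_mean f b \<Longrightarrow> a = b"
  unfolding has_mean_def by (rule tendsto_unique[OF box_filter_neq_bot])

lemma mean_dist_le:
  assumes "has_mean f a" "has_mean p c" "has_mean q d" "\<And>x. cmod (f x - p x) \<le> Re (q x)"
  shows "cmod (a - c) \<le> Re d"
proof (rule tendsto_le[OF box_filter_neq_bot])
  show "((\<lambda>P. Re (avg q P)) \<longlongrightarrow> Re d) box_filter"
    using assms(3) unfolding has_mean_def by (intro tendsto_intros)
  show "((\<lambda>P. cmod (avg f P - avg p P)) \<longlongrightarrow> cmod (a - c)) box_filter"
    using assms(1,2) unfolding has_mean_def by (intro tendsto_intros)
  show "\<forall>\<^sub>F P in box_filter. cmod (avg f P - avg p P) \<le> Re (avg q P)"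
    using norm_avg_le[of "\<lambda>x. f x - p x" q] assms(4) by (simp add: avg_diff)
qed

text \<open>Far out, the averages of \<open>f\<close> stay within \<open>Re (avg q P)\<close> of
  those of \<open>p\<close>, which converge. The averages of \<open>f\<close> are therefore Cauchy
  along the filter and converge to a limit that is not identified.\<close>

lemma has_mean_approx:
  assumes "\<And>\<epsilon>. \<epsilon> > 0 \<Longrightarrow> \<exists>p q c d. has_mean p c \<and> has_mean q d \<and>
      (\<forall>x. cmod (f x - p x) \<le> Re (q x)) \<and> Re d < \<epsilon>"
  shows "\<exists>a. has_mean f a"
proof -
  have "cauchy_filter (filtermap (avg f) box_filter)"
    unfolding cauchy_filter_metric_filtermap
  proof (intro allI impI)
    fix \<epsilon> :: real assume "\<epsilon> > 0"
    then obtain p q c d where *: "has_mean p c" "has_mean q d"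
      "\<forall>x. cmod (f x - p x) \<le> Re (q x)" "Re d < \<epsilon> / 4"
      using assms[of "\<epsilon> / 4"] by auto
    have "\<forall>\<^sub>F P in box_filter. dist (avg p P) c < \<epsilon> / 4"
      using *(1) \<open>\<epsilon> > 0\<close> unfolding has_mean_def by (intro tendstoD) auto
    moreover have "((\<lambda>P. Re (avg q P)) \<longlongrightarrow> Re d) box_filter"
      using *(2) unfolding has_mean_def by (intro tendsto_intros)
    then have "\<forall>\<^sub>F P in box_filter. Re (avg q P) < \<epsilon> / 4"
      using *(4) by (rule order_tendstoD)
    ultimately have "\<forall>\<^sub>F P in box_filter. dist (avg f P) c < \<epsilon> / 2"
    proof eventually_elim
      case (elim P)
      have "cmod (avg f P - avg p P) \<le> Re (avg q P)"
        using norm_avg_le[of "\<lambda>x. f x - p x" q P] *(3) by (simp add: avg_diff)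
      then have "dist (avg f P) (avg p P) < \<epsilon> / 4" using elim by (simp add: dist_norm)
      then show ?case using elim dist_triangle[of "avg f P" c "avg p P"] by simp
    qed
    then show "\<exists>Q. eventually Q box_filter \<and> (\<forall>x y. Q x \<and> Q y \<longrightarrow> dist (avg f x) (avg f y) < \<epsilon>)"
      by (intro exI[of _ "\<lambda>P. dist (avg f P) c < \<epsilon> / 2"]) (auto intro: dist_triangle_half_l)
  qed
  then obtain a where "filtermap (avg f) box_filter \<le> nhds a"
    using cauchy_filter_complete_converges[OF _ complete_UNIV, of "filtermap (avg f) box_filter"]
    by (auto simp: filtermap_bot_iff)
  then show ?thesis unfolding has_mean_def filterlim_def by blast
qed

section \<open>Characters of the lattice and their means\<close>

definition int_vecs :: "(real ^ 'n) set" where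
  "int_vecs = range of_int_vec"

lemma int_vecs_iff: "\<theta> \<in> int_vecs \<longleftrightarrow> (\<forall>k. \<theta> $ k \<in> \<int>)"
proof
  assume "\<forall>k. \<theta> $ k \<in> \<int>"
  then have "\<theta> = of_int_vec (\<chi> k. \<lfloor>\<theta> $ k\<rfloor>)"
    by (auto simp: of_int_vec_def vec_eq_iff elim!: Ints_cases)
  then show "\<theta> \<in> int_vecs" unfolding int_vecs_def by blast
qed (auto simp: int_vecs_def of_int_vec_def)

definition lattice_char :: "real ^ 'n \<Rightarrow> int ^ 'n \<Rightarrow> complex" where
  "lattice_char \<theta> x = cis (2 * pi * (\<theta> \<bullet> of_int_vec x))"

lemma lattice_char_add: "lattice_char (\<theta> + \<eta>) x = lattice_char \<theta> x * lattice_char \<eta> x"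
  by (simp add: lattice_char_def cis_mult inner_add_left algebra_simps)

lemma norm_lattice_char [simp]: "cmod (lattice_char \<theta> x) = 1"
  by (simp add: lattice_char_def)

lemma cis_Ints [simp]: "r \<in> \<int> \<Longrightarrow> cis (2 * pi * r) = 1"
  by (auto simp: cis_multiple_2pi)

lemma cis_eq_1_Ints: "cis (2 * pi * r) = 1 \<longleftrightarrow> r \<in> \<int>"
proof
  assume "cis (2 * pi * r) = 1"
  then have "cos (2 * pi * r) = 1" by (metis cis.sel(1) one_complex.sel(1))
  then obtain k :: int where "2 * pi * r = of_int k * 2 * pi" by (auto simp: cos_one_2pi_int)
  then have "r = of_int k" by simp
  then show "r \<in> \<int>" by simp
qed simp

lemma prod_cis: "(\<Prod>k\<in>A. cis (g k)) = cis (sum g A)"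
  by (induct A rule: infinite_finite_induct) (auto simp: cis_mult)

lemma lattice_char_prod: "lattice_char \<theta> x = (\<Prod>k\<in>UNIV. cis (2 * pi * (\<theta> $ k * of_int (x $ k))))"
  by (simp add: prod_cis lattice_char_def inner_vec_def of_int_vec_def sum_distrib_left)

lemma bij_betw_box_int:
  "bij_betw (\<lambda>h. \<chi> k. h k) (Pi\<^sub>E UNIV (\<lambda>k. {a $ k..<a $ k + int (l $ k)})) (box_int a l)"
  by (rule bij_betwI[where g = vec_nth]) (auto simp: box_int_def PiE_iff)

text \<open>A box is a product of intervals, so a sum of products of one-coordinate factors splits.
  With all factors equal to 1 this also counts the box.\<close>

lemma sum_box_int:
  "(\<Sum>x\<in>box_int a l. \<Prod>k\<in>UNIV. f k (x $ k)) =
   (\<Prod>k\<in>UNIV. \<Sum>j\<in>{a $ k..<a $ k + int (l $ k)}. f k j :: 'a::comm_semiring_1)"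
  by (subst prod_sum_PiE) (auto simp: sum.reindex_bij_betw[OF bij_betw_box_int, symmetric])

lemma card_box_int: "card (box_int a l) = (\<Prod>k\<in>UNIV. l $ k)"
  using sum_box_int[of "\<lambda>_ _. 1::nat" a l] by simp

text \<open>Geometric series. The bound depends neither on the start \<open>a\<close> nor on the
  length \<open>n\<close>, which makes the resulting mean uniform in the position of the
  box.\<close>

lemma norm_sum_cis_le:
  assumes "t \<notin> \<int>"
  shows "cmod (\<Sum>j\<in>{a..<a + int n}. cis (2 * pi * (t * of_int j))) \<le> 2 / cmod (1 - cis (2 * pi * t))"
proof -
  let ?w = "cis (2 * pi * t)"
  have w: "?w \<noteq> 1" using assms cis_eq_1_Ints by blast
  have "bij_betw (\<lambda>i. a + int i) {..<n} {a..<a + int n}"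
    by (rule bij_betwI[where g = "\<lambda>j. nat (j - a)"]) auto
  then have "(\<Sum>j\<in>{a..<a + int n}. cis (2 * pi * (t * of_int j)))
    = (\<Sum>i<n. cis (2 * pi * (t * of_int (a + int i))))"
    by (rule sum.reindex_bij_betw[symmetric])
  also have "\<dots> = (\<Sum>i<n. cis (2 * pi * (t * of_int a)) * ?w ^ i)"
    by (intro sum.cong refl) (simp add: cis_mult Complex.DeMoivre algebra_simps)
  also have "\<dots> = cis (2 * pi * (t * of_int a)) * ((1 - ?w ^ n) / (1 - ?w))"
    using w by (simp add: sum_distrib_left[symmetric] sum_gp_strict)
  also have "cmod \<dots> \<le> 2 / cmod (1 - ?w)"
  proof -
    have "cmod (1 - ?w ^ n) \<le> 2" using norm_triangle_ineq4[of 1 "?w ^ n"] by (simp add: norm_power)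
    then show ?thesis by (simp add: norm_mult norm_divide divide_right_mono)
  qed
  finally show ?thesis .
qed

lemma has_mean_const: "has_mean (\<lambda>_. c) c"
proof -
  \<comment> \<open>Boxes with an empty side are excluded: their average is 0 by the convention for
    division by 0.\<close>
  have "avg (\<lambda>_. c) P = c" if Q: "P \<in> boxes_ge 1" for P :: "(int ^ 'b) set"
  proof -
    obtain a l where P: "P = box_int a l" "\<forall>k. 1 \<le> l $ k" using Q unfolding boxes_ge_def by auto
    then have "card P \<noteq> 0" by (simp add: card_box_int Suc_le_eq)
    then show ?thesis by (simp add: avg_def)
  qed
  then have "\<forall>\<^sub>F P :: (int ^ 'b) set in box_filter. avg (\<lambda>_. c) P = c"
    unfolding eventually_box_filter by blast
  then show ?thesis unfolding has_mean_def by (rule tendsto_eventually)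
qed

lemma lattice_char_int_vecs: "\<theta> \<in> int_vecs \<Longrightarrow> lattice_char \<theta> x = 1"
  by (auto simp: lattice_char_prod int_vecs_iff intro!: prod.neutral)

text \<open>One nonintegral coordinate suffices: its geometric sum is at most \<open>C\<close>,
  every other factor is at most its side length, so the average is at most \<open>C\<close> divided
  by the side in that direction.\<close>

lemma has_mean_lattice_char: "has_mean (lattice_char \<theta>) (if \<theta> \<in> int_vecs then 1 else 0)"
proof (cases "\<theta> \<in> int_vecs")
  case True
  then have "lattice_char \<theta> = (\<lambda>_. 1)"
    by (simp add: fun_eq_iff lattice_char_int_vecs)
  then show ?thesis using has_mean_const[of 1] True by simp
next
  case False
  then obtain m where m: "\<theta> $ m \<notin> \<int>" by (auto simp: int_vecs_iff)
  define C where "C = 2 / cmod (1 - cis (2 * pi * \<theta> $ m))"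
  have C: "C \<ge> 0" by (simp add: C_def)
  have bound: "cmod (avg (lattice_char \<theta>) P) \<le> C / real N" if P: "P \<in> boxes_ge N" "N \<ge> 1" for P N
  proof -
    obtain a l where al: "P = box_int a l" "\<forall>k. N \<le> l $ k" using P unfolding boxes_ge_def by auto
    let ?s = "\<lambda>k. \<Sum>j\<in>{a $ k..<a $ k + int (l $ k)}. cis (2 * pi * (\<theta> $ k * of_int j))"
    have lpos: "l $ k > 0" for k using al(2) P(2) by (metis One_nat_def Suc_le_lessD order_trans)
    have "cmod (\<Sum>x\<in>P. lattice_char \<theta> x) = (\<Prod>k\<in>UNIV. cmod (?s k))"
      unfolding lattice_char_prod al(1)
      by (subst sum_box_int[where f = "\<lambda>k j. cis (2 * pi * (\<theta> $ k * of_int j))"]) (simp add: prod_norm)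
    also have "\<dots> = cmod (?s m) * (\<Prod>k\<in>UNIV - {m}. cmod (?s k))"
      by (rule prod.remove) auto
    also have "\<dots> \<le> C * (\<Prod>k\<in>UNIV - {m}. real (l $ k))"
    proof (intro mult_mono prod_mono conjI)
      show "cmod (?s m) \<le> C" unfolding C_def by (rule norm_sum_cis_le[OF m])
      fix k
      have "cmod (?s k) \<le> (\<Sum>j\<in>{a $ k..<a $ k + int (l $ k)}. 1)"
        by (intro sum_norm_le) simp
      then show "cmod (?s k) \<le> real (l $ k)" by simp
    qed (auto simp: C intro: prod_nonneg)
    finally have "cmod (avg (lattice_char \<theta>) P) \<le> C * (\<Prod>k\<in>UNIV - {m}. real (l $ k)) / (\<Prod>k\<in>UNIV. real (l $ k))"
      unfolding avg_def al(1) by (simp add: norm_divide card_box_int divide_right_mono prod_nonneg prod_norm[symmetric])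
    also have "\<dots> = C / real (l $ m)"
      using lpos by (subst prod.remove[of UNIV m]) (auto simp: prod_zero_iff)
    also have "\<dots> \<le> C / real N"
      using al(2) P(2) C by (intro divide_left_mono) (auto intro!: mult_pos_pos lpos)
    finally show ?thesis .
  qed
  have "(avg (lattice_char \<theta>) \<longlongrightarrow> 0) box_filter"
  proof (rule tendstoI)
    fix e :: real assume "e > 0"
    \<comment> \<open>As \<open>C / e\<close> is nonnegative, the summand 1 forces
      \<open>N >= 1\<close>.\<close>
    obtain N where N: "real N > C / e + 1" using reals_Archimedean2 by blast
    have "C / e \<ge> 0" using C \<open>e > 0\<close> by simp
    then have N1: "N \<ge> 1" using N by linarith
    have "C / real N < e"
    proof -
      have "C / e < real N" using N by linarith
      then show ?thesis using \<open>e > 0\<close> N1 by (simp add: field_simps)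
    qed
    then show "\<forall>\<^sub>F P in box_filter. dist (avg (lattice_char \<theta>) P) 0 < e"
      unfolding eventually_box_filter using bound[OF _ N1] by (intro exI[of _ N]) fastforce
  qed
  then show ?thesis using False by (simp add: has_mean_def)
qed

section \<open>Approximation by trigonometric polynomials\<close>

lemma finite_box_int: "finite (box_int a l)"
  using bij_betw_finite[OF bij_betw_box_int[of a l]] by (simp add: finite_PiE)

lemma density_tendsto:
  assumes "has_mean (\<lambda>x. of_bool (x \<in> A)) c"
  shows "(density_in A \<longlongrightarrow> Re c) box_filter"
proof -
  have "Re (avg (\<lambda>x. of_bool (x \<in> A)) P) = density_in A P" if "P \<in> boxes_ge 0" for P
  proof -
    have "finite P" using that finite_box_int unfolding boxes_ge_def by blast
    then have "(\<Sum>x\<in>P. of_bool (x \<in> A)) = complex_of_nat (card (A \<inter> P))"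
      by (simp add: of_bool_def sum.If_cases Int_commute)
    then show ?thesis by (simp add: avg_def density_in_def Re_divide_of_nat)
  qed
  then have "\<forall>\<^sub>F P in box_filter. Re (avg (\<lambda>x. of_bool (x \<in> A)) P) = density_in A P"
    unfolding eventually_box_filter by blast
  moreover have "((\<lambda>P. Re (avg (\<lambda>x. of_bool (x \<in> A)) P)) \<longlongrightarrow> Re c) box_filter"
    using assms unfolding has_mean_def by (intro tendsto_intros)
  ultimately show ?thesis by (rule Lim_transform_eventually[rotated])
qed

text \<open>A limit exists by \<open>has_mean_approx\<close>; the mean \<open>c\<close> of the
  approximant is close to it by domination and close to \<open>m\<close> by assumption.\<close>

lemma has_mean_eqI:
  assumes "\<And>\<epsilon>. \<epsilon> > 0 \<Longrightarrow> \<exists>p q c d. has_mean p c \<and> has_mean q d \<and>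
      (\<forall>x. cmod (f x - p x) \<le> Re (q x)) \<and> Re d < \<epsilon> \<and> cmod (c - m) \<le> \<epsilon>"
  shows "has_mean f m"
proof -
  obtain a where a: "has_mean f a" using has_mean_approx[of f] assms by meson
  have "cmod (a - m) \<le> 0"
  proof (rule field_le_epsilon)
    fix e :: real assume "e > 0"
    then obtain p q c d where *: "has_mean p c" "has_mean q d"
      "\<forall>x. cmod (f x - p x) \<le> Re (q x)" "Re d < e / 2" "cmod (c - m) \<le> e / 2"
      using assms[of "e / 2"] by auto
    have "cmod (a - c) \<le> Re d" using mean_dist_le[OF a *(1,2)] *(3) by blast
    then show "cmod (a - m) \<le> 0 + e"
      using *(4,5) norm_triangle_ineq[of "a - c" "c - m"] by simp
  qed
  then show ?thesis using a by simp
qed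

lemma norm_mean_le:
  assumes "has_mean f a" "\<And>x. cmod (f x) \<le> C"
  shows "cmod a \<le> C"
  using mean_dist_le[OF assms(1) has_mean_const[of 0] has_mean_const[of "of_real C"]] assms(2) by simp

text \<open>Closed under sums only: products are formed just between polynomials over two
  independent frequency sets, and these are treated at the level of means.\<close>

inductive_set trig :: "(real ^ 'n) set \<Rightarrow> (int ^ 'n \<Rightarrow> complex) set" for \<Gamma> where
  mono: "\<theta> \<in> \<Gamma> \<Longrightarrow> (\<lambda>x. c * lattice_char \<theta> x) \<in> trig \<Gamma>"
| add: "p \<in> trig \<Gamma> \<Longrightarrow> q \<in> trig \<Gamma> \<Longrightarrow> (\<lambda>x. p x + q x) \<in> trig \<Gamma>"

lemma trig_mono: "\<Gamma> \<subseteq> \<Gamma>' \<Longrightarrow> p \<in> trig \<Gamma> \<Longrightarrow> p \<in> trig \<Gamma>'"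
  by (erule trig.induct) (auto intro: trig.intros)

lemma trig_has_mean: "p \<in> trig \<Gamma> \<Longrightarrow> \<exists>c. has_mean p c"
proof (induct rule: trig.induct)
  case (mono \<theta> c)
  show ?case using has_mean_cmult[OF has_mean_lattice_char] by blast
next
  case (add p q)
  then show ?case using has_mean_add[of p _ q] by blast
qed

lemma trig_bounded: "p \<in> trig \<Gamma> \<Longrightarrow> \<exists>C\<ge>0. \<forall>x. cmod (p x) \<le> C"
proof (induct rule: trig.induct)
  case (mono \<theta> c)
  show ?case by (rule exI[of _ "cmod c"]) (simp add: norm_mult)
next
  case (add p q)
  then obtain C D where "C \<ge> 0" "\<forall>x. cmod (p x) \<le> C" "D \<ge> 0" "\<forall>x. cmod (q x) \<le> D" by blast
  then show ?case by (intro exI[of _ "C + D"]) (auto intro: norm_triangle_mono)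
qed

text \<open>
  The error is dominated pointwise, rather than merely small in mean, so that the approximation
  survives composition with a map preserving only the means of characters.
\<close>

definition trig_approximable :: "(real ^ 'n) set \<Rightarrow> (int ^ 'n \<Rightarrow> complex) \<Rightarrow> bool" where
  "trig_approximable \<Gamma> f \<longleftrightarrow> (\<forall>\<epsilon>>0. \<exists>p\<in>trig \<Gamma>. \<exists>q\<in>trig \<Gamma>. \<exists>d.
     (\<forall>x. cmod (f x - p x) \<le> Re (q x)) \<and> has_mean q d \<and> Re d < \<epsilon>)"

lemma trig_approximableD:
  assumes "trig_approximable \<Gamma> f" "\<epsilon> > 0"
  shows "\<exists>p q c d. p \<in> trig \<Gamma> \<and> q \<in> trig \<Gamma> \<and> (\<forall>x. cmod (f x - p x) \<le> Re (q x)) \<and>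
    has_mean p c \<and> has_mean q d \<and> Re d < \<epsilon>"
  using assms trig_has_mean unfolding trig_approximable_def by meson

lemma trig_approximable_mono: "trig_approximable \<Gamma> f \<Longrightarrow> \<Gamma> \<subseteq> \<Gamma>' \<Longrightarrow> trig_approximable \<Gamma>' f"
  unfolding trig_approximable_def by (meson trig_mono)

lemma trig_approximable_has_mean: "trig_approximable \<Gamma> f \<Longrightarrow> \<exists>a. has_mean f a"
  by (rule has_mean_approx) (blast dest: trig_approximableD)

lemma trig_approximable_lattice_char: "\<theta> \<in> \<Gamma> \<Longrightarrow> trig_approximable \<Gamma> (lattice_char \<theta>)"
  unfolding trig_approximable_def
proof (intro allI impI)
  fix e :: real assume "\<theta> \<in> \<Gamma>" "e > 0"
  then have "lattice_char \<theta> \<in> trig \<Gamma>" "(\<lambda>x. 0) \<in> trig \<Gamma>"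
    using trig.mono[of \<theta> \<Gamma> 1] trig.mono[of \<theta> \<Gamma> 0] by auto
  then show "\<exists>p\<in>trig \<Gamma>. \<exists>q\<in>trig \<Gamma>. \<exists>d.
     (\<forall>x. cmod (lattice_char \<theta> x - p x) \<le> Re (q x)) \<and> has_mean q d \<and> Re d < e"
    using has_mean_const[of 0] \<open>e > 0\<close>
    by (intro bexI[of _ "lattice_char \<theta>"] bexI[of _ "\<lambda>x. 0"] exI[of _ 0]) auto
qed

lemma int_vecs_add: "\<theta> \<in> int_vecs \<Longrightarrow> \<eta> \<in> int_vecs \<Longrightarrow> \<theta> + \<eta> \<in> int_vecs"
  by (simp add: int_vecs_iff)

text \<open>Since a character has mean 1 or 0, this is what makes the mean of a product of two
  characters, one from each set, equal to the product of their means.\<close>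

definition char_independent :: "(real ^ 'n) set \<Rightarrow> (real ^ 'n) set \<Rightarrow> bool" where
  "char_independent \<Gamma> \<Gamma>' \<longleftrightarrow>
     (\<forall>\<theta>\<in>\<Gamma>. \<forall>\<eta>\<in>\<Gamma>'. \<theta> + \<eta> \<in> int_vecs \<longrightarrow> \<theta> \<in> int_vecs \<and> \<eta> \<in> int_vecs)"

lemma trig_mult_has_mean:
  assumes ind: "char_independent \<Gamma> \<Gamma>'" and p: "p \<in> trig \<Gamma>" and q: "q \<in> trig \<Gamma>'"
    and c: "has_mean p c" and d: "has_mean q d"
  shows "has_mean (\<lambda>x. p x * q x) (c * d)"
proof -
  let ?m = "\<lambda>\<theta>. if \<theta> \<in> int_vecs then 1 else 0"
  \<comment> \<open>The mean of \<open>q\<close> is quantified inside because the induction replaces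
    \<open>q\<close> by its summands; uniqueness of means later identifies it with the given
    \<open>d\<close>.\<close>
  have one: "\<exists>d. has_mean q d \<and> has_mean (\<lambda>x. b * lattice_char \<theta> x * q x) (b * ?m \<theta> * d)"
    if "\<theta> \<in> \<Gamma>" for \<theta> b
    using q
  proof induct
    case (mono \<eta> b')
    have "has_mean (\<lambda>x. b * b' * lattice_char (\<theta> + \<eta>) x) (b * b' * ?m (\<theta> + \<eta>))"
      by (intro has_mean_cmult has_mean_lattice_char)
    moreover have "?m (\<theta> + \<eta>) = (?m \<theta> * ?m \<eta> :: complex)"
      using ind \<open>\<theta> \<in> \<Gamma>\<close> mono int_vecs_add unfolding char_independent_def by auto
    ultimately have "has_mean (\<lambda>x. b * lattice_char \<theta> x * (b' * lattice_char \<eta> x)) (b * ?m \<theta> * (b' * ?m \<eta>))"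
      by (simp only: lattice_char_add ac_simps)
    then show ?case using has_mean_cmult[OF has_mean_lattice_char] by blast
  next
    case (add q q')
    then obtain d d' where "has_mean q d" "has_mean (\<lambda>x. b * lattice_char \<theta> x * q x) (b * ?m \<theta> * d)"
      "has_mean q' d'" "has_mean (\<lambda>x. b * lattice_char \<theta> x * q' x) (b * ?m \<theta> * d')" by blast
    then show ?case
      by (intro exI[of _ "d + d'"]) (simp only: distrib_left has_mean_add simp_thms)
  qed
  have "\<exists>c. has_mean p c \<and> has_mean (\<lambda>x. p x * q x) (c * d)"
    using p
  proof induct
    case (mono \<theta> b)
    from one[OF mono, of b] obtain d' where "has_mean q d'"
      "has_mean (\<lambda>x. b * lattice_char \<theta> x * q x) (b * ?m \<theta> * d')" by blast
    moreover have "d' = d" using calculation d has_mean_unique by blast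
    ultimately show ?case using has_mean_cmult[OF has_mean_lattice_char] by blast
  next
    case (add p p')
    then obtain c c' where "has_mean p c" "has_mean (\<lambda>x. p x * q x) (c * d)"
      "has_mean p' c'" "has_mean (\<lambda>x. p' x * q x) (c' * d)" by blast
    then show ?case
      by (intro exI[of _ "c + c'"]) (simp only: distrib_right has_mean_add simp_thms)
  qed
  then show ?thesis using c has_mean_unique by blast
qed

text \<open>Write fg - pp' = (f - p)g + p(g - p'). As |g| is at most 1 and |p| at most C, the error
  has the majorant q + Cq', a plain sum, whose mean follows by linearity.\<close>

lemma trig_approximable_mult_has_mean:
  assumes ind: "char_independent \<Gamma> \<Gamma>'"
    and f: "trig_approximable \<Gamma> f" "has_mean f a"
    and g: "trig_approximable \<Gamma>' g" "has_mean g b" "\<And>x. cmod (g x) \<le> 1"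
  shows "has_mean (\<lambda>x. f x * g x) (a * b)"
proof (rule has_mean_eqI)
  fix \<epsilon> :: real assume e: "\<epsilon> > 0"
  have "\<epsilon> / 2 > 0" using e by simp
  from trig_approximableD[OF f(1) this]
  obtain p q c d where p: "p \<in> trig \<Gamma>" "\<And>x. cmod (f x - p x) \<le> Re (q x)"
    "has_mean p c" "has_mean q d" "Re d < \<epsilon> / 2" by blast
  obtain C where C: "C \<ge> 0" "\<And>x. cmod (p x) \<le> C" using trig_bounded[OF p(1)] by blast
  \<comment> \<open>The approximation of \<open>g\<close> is chosen after that of \<open>f\<close>,
    since its error gets multiplied by the bound \<open>C\<close> of \<open>p\<close>;
    \<open>C + 1\<close> avoids a division by 0.\<close>
  have "\<epsilon> / (2 * (C + 1)) > 0" using e C(1) by simp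
  from trig_approximableD[OF g(1) this]
  obtain p' q' c' d' where p': "p' \<in> trig \<Gamma>'" "\<And>x. cmod (g x - p' x) \<le> Re (q' x)"
    "has_mean p' c'" "has_mean q' d'" "Re d' < \<epsilon> / (2 * (C + 1))" by blast
  have ac: "cmod (a - c) \<le> Re d" by (rule mean_dist_le[OF f(2) p(3,4,2)])
  have bc: "cmod (b - c') \<le> Re d'" by (rule mean_dist_le[OF g(2) p'(3,4,2)])
  have b1: "cmod b \<le> 1" by (rule norm_mean_le[OF g(2,3)])
  have cC: "cmod c \<le> C" by (rule norm_mean_le[OF p(3) C(2)])
  have "C * Re d' \<le> (C + 1) * Re d'"
    using order_trans[OF norm_ge_zero bc] by (simp add: distrib_right)
  also have "\<dots> < \<epsilon> / 2" using p'(5) C(1) by (simp add: field_simps)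
  finally have small: "Re d + C * Re d' < \<epsilon>" using p(5) by linarith
  show "\<exists>p q c d. has_mean p c \<and> has_mean q d \<and>
      (\<forall>x. cmod (f x * g x - p x) \<le> Re (q x)) \<and> Re d < \<epsilon> \<and> cmod (c - a * b) \<le> \<epsilon>"
  proof (rule exI[of _ "\<lambda>x. p x * p' x"], rule exI[of _ "\<lambda>x. q x + of_real C * q' x"],
      rule exI[of _ "c * c'"], rule exI[of _ "d + of_real C * d'"], intro conjI allI)
    show "has_mean (\<lambda>x. p x * p' x) (c * c')" by (rule trig_mult_has_mean[OF ind p(1) p'(1) p(3) p'(3)])
    show "has_mean (\<lambda>x. q x + of_real C * q' x) (d + of_real C * d')"
      by (intro has_mean_add has_mean_cmult p p')
    show "Re (d + of_real C * d') < \<epsilon>" using small by simp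
    fix x
    have "f x * g x - p x * p' x = (f x - p x) * g x + p x * (g x - p' x)" by (simp add: algebra_simps)
    also have "cmod \<dots> \<le> cmod (f x - p x) * cmod (g x) + cmod (p x) * cmod (g x - p' x)"
      by (metis norm_triangle_ineq norm_mult)
    also have "\<dots> \<le> Re (q x) * 1 + C * Re (q' x)"
      using order_trans[OF norm_ge_zero p(2)] by (intro add_mono mult_mono p p' g C) auto
    finally show "cmod (f x * g x - p x * p' x) \<le> Re (q x + of_real C * q' x)" by simp
  next
    have "c * c' - a * b = (c - a) * b + c * (c' - b)" by (simp add: algebra_simps)
    also have "cmod \<dots> \<le> cmod (c - a) * cmod b + cmod c * cmod (c' - b)"
      by (metis norm_triangle_ineq norm_mult)
    also have "\<dots> \<le> Re d * 1 + C * Re d'"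
      using ac bc b1 cC C(1) order_trans[OF norm_ge_zero ac]
      by (intro add_mono mult_mono) (auto simp: norm_minus_commute)
    finally show "cmod (c * c' - a * b) \<le> \<epsilon>" using small by simp
  qed
qed

text \<open>An inequality valid at every point may be read at \<open>T x\<close>, and the majorant
  composed with \<open>T\<close> keeps its mean. This reduces invariance on all approximable
  functions to the characters over \<open>\<Gamma>\<close>.\<close>

lemma trig_approximable_has_mean_compose:
  assumes T: "\<And>\<theta>. \<theta> \<in> \<Gamma> \<Longrightarrow> has_mean (\<lambda>x. lattice_char \<theta> (T x)) (if \<theta> \<in> int_vecs then 1 else 0)"
    and f: "trig_approximable \<Gamma> f" "has_mean f a"
  shows "has_mean (\<lambda>x. f (T x)) a"
proof -
  have trig: "has_mean (\<lambda>x. p (T x)) c" if "p \<in> trig \<Gamma>" "has_mean p c" for p c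
  proof -
    have "\<exists>c. has_mean p c \<and> has_mean (\<lambda>x. p (T x)) c"
      using \<open>p \<in> trig \<Gamma>\<close>
    proof induct
      case (mono \<theta> b)
      show ?case using has_mean_cmult[OF has_mean_lattice_char] has_mean_cmult[OF T[OF mono]] by blast
    next
      case (add p q)
      then obtain c c' where "has_mean p c" "has_mean (\<lambda>x. p (T x)) c"
        "has_mean q c'" "has_mean (\<lambda>x. q (T x)) c'" by blast
      then show ?case by (intro exI[of _ "c + c'"] conjI has_mean_add)
    qed
    then show ?thesis using that(2) has_mean_unique by blast
  qed
  show ?thesis
  proof (rule has_mean_eqI)
    fix \<epsilon> :: real assume "\<epsilon> > 0"
    from trig_approximableD[OF f(1) this]
    obtain p q c d where *: "p \<in> trig \<Gamma>" "q \<in> trig \<Gamma>" "\<And>x. cmod (f x - p x) \<le> Re (q x)"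
      "has_mean p c" "has_mean q d" "Re d < \<epsilon>" by blast
    have "cmod (a - c) \<le> Re d" by (rule mean_dist_le[OF f(2) *(4,5,3)])
    then show "\<exists>p q c d. has_mean p c \<and> has_mean q d \<and>
      (\<forall>x. cmod (f (T x) - p x) \<le> Re (q x)) \<and> Re d < \<epsilon> \<and> cmod (c - a) \<le> \<epsilon>"
      using trig[OF *(1,4)] trig[OF *(2,5)] *(3,6)
      by (intro exI[of _ "\<lambda>x. p (T x)"] exI[of _ "\<lambda>x. q (T x)"] exI[of _ c] exI[of _ d])
         (auto simp: norm_minus_commute)
  qed
qed

section \<open>Trigonometric polynomials on the torus\<close>

text \<open>Setting the coordinates off \<open>I\<close> to 1 makes the torus a compact set in the
  type \<open>'i \<Rightarrow> complex\<close> with its own topology, where Stone-Weierstrass and,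
  for countable \<open>'i\<close>, \<open>infdist\<close> apply.\<close>

definition torus_map :: "'i set \<Rightarrow> ('i \<Rightarrow> real) \<Rightarrow> 'i \<Rightarrow> complex" where
  "torus_map I t = (\<lambda>i. if i \<in> I then cis (2 * pi * t i) else 1)"

definition torus :: "'i set \<Rightarrow> ('i \<Rightarrow> complex) set" where
  "torus I = Pi\<^sub>E UNIV (\<lambda>i. if i \<in> I then sphere 0 1 else {1})"

lemma compact_torus: "compact (torus I)"
proof -
  have "compactin (product_topology (\<lambda>i. euclidean) UNIV) (torus I)"
    unfolding torus_def by (subst compactin_PiE) auto
  then show ?thesis by (simp add: euclidean_product_topology)
qed

lemma torus_map_in_torus: "torus_map I t \<in> torus I"
  by (auto simp: torus_map_def torus_def)

lemma torus_map_surj: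
  assumes "z \<in> torus I" obtains t where "t \<in> Pi\<^sub>E I (\<lambda>_. UNIV)" "torus_map I t = z"
proof
  have "cis (Arg (z i)) = z i" if "i \<in> I" for i
  proof -
    have "cmod (z i) = 1" using assms that by (auto simp: torus_def PiE_iff split: if_splits)
    moreover from this have "z i \<noteq> 0" by auto
    ultimately show ?thesis using cis_Arg[of "z i"] by (simp add: sgn_eq)
  qed
  then show "torus_map I (\<lambda>i\<in>I. Arg (z i) / (2 * pi)) = z"
    using assms by (auto simp: torus_map_def torus_def PiE_iff fun_eq_iff split: if_splits)
qed auto

lemma torus_map_eq_iff: "torus_map I s = torus_map I t \<longleftrightarrow> (\<forall>i\<in>I. s i - t i \<in> \<int>)"
proof -
  have "cis (2 * pi * a) = cis (2 * pi * b) \<longleftrightarrow> a - b \<in> \<int>" for a b :: real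
  proof -
    have "cis (2 * pi * a) = cis (2 * pi * b) \<longleftrightarrow> cis (2 * pi * a) / cis (2 * pi * b) = 1" by simp
    also have "\<dots> \<longleftrightarrow> cis (2 * pi * (a - b)) = 1" by (simp add: cis_divide right_diff_distrib)
    finally show ?thesis by (simp only: cis_eq_1_Ints)
  qed
  then show ?thesis by (auto simp: torus_map_def fun_eq_iff)
qed

lemma continuous_map_torus_map:
  "continuous_map (product_topology (\<lambda>_. euclideanreal) I) euclidean (torus_map I)"
proof -
  have "continuous_map (product_topology (\<lambda>_. euclideanreal) I) euclidean (\<lambda>t. torus_map I t i)" for i
  proof (cases "i \<in> I")
    case True
    have "continuous_map euclidean euclidean (\<lambda>x. cis (2 * pi * x))"
      by (intro continuous_intros continuous_map_iff_continuous2[THEN iffD2])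
    from continuous_map_compose[OF continuous_map_product_projection[OF True] this]
    show ?thesis using True by (simp add: torus_map_def o_def)
  qed (simp add: torus_map_def)
  then show ?thesis
    by (simp add: euclidean_product_topology[symmetric] continuous_map_componentwise_UNIV)
qed

text \<open>The principal argument provides continuous local sections of the covering map.\<close>

lemma openin_torus_map_image:
  assumes I: "finite I" and W: "openin (product_topology (\<lambda>_. euclideanreal) I) W"
  shows "openin (top_of_set (torus I)) (torus_map I ` W)"
proof (subst openin_subopen, intro ballI)
  fix z0 assume "z0 \<in> torus_map I ` W"
  then obtain t0 where t0: "t0 \<in> W" "z0 = torus_map I t0" by blast
  have t0I: "t0 \<in> Pi\<^sub>E I (\<lambda>_. UNIV)" using openin_subset[OF W] t0 by auto
  have z0: "z0 i = cis (2 * pi * t0 i)" if "i \<in> I" for i using that t0 by (simp add: torus_map_def)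
  \<comment> \<open>Near \<open>z0\<close> the ratios \<open>z i / z0 i\<close> avoid the cut of
    \<open>Arg\<close>, the nonpositive reals; on \<open>S\<close> the map \<open>l\<close> is a
    section of the covering that takes \<open>z0\<close> back to \<open>t0\<close>.\<close>
  define S where "S = torus I \<inter> {z. \<forall>i\<in>I. z i / z0 i \<in> - \<real>\<^sub>\<le>\<^sub>0}"
  define l where "l z = (\<lambda>i\<in>I. t0 i + Arg (z i / z0 i) / (2 * pi))" for z
  have "open (\<Inter>i\<in>I. (\<lambda>z::'a \<Rightarrow> complex. z i / z0 i) -` (- \<real>\<^sub>\<le>\<^sub>0))"
    using z0 by (intro open_INT I ballI open_vimage continuous_intros continuous_on_product_coordinates) auto
  also have "(\<Inter>i\<in>I. (\<lambda>z::'a \<Rightarrow> complex. z i / z0 i) -` (- \<real>\<^sub>\<le>\<^sub>0)) = {z. \<forall>i\<in>I. z i / z0 i \<in> - \<real>\<^sub>\<le>\<^sub>0}"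
    by auto
  finally have S: "openin (top_of_set (torus I)) S" unfolding S_def by (rule openin_open_Int)
  have "continuous_map (top_of_set S) (product_topology (\<lambda>_. euclideanreal) I) l"
    unfolding continuous_map_componentwise
  proof (intro conjI ballI)
    fix i assume "i \<in> I"
    have "continuous_on S (\<lambda>z. t0 i + Arg (z i / z0 i) / (2 * pi))"
      using \<open>i \<in> I\<close> z0
      by (intro continuous_intros continuous_on_subset[OF continuous_on_product_coordinates]) (auto simp: S_def)
    then show "continuous_map (top_of_set S) euclideanreal (\<lambda>z. l z i)"
      using \<open>i \<in> I\<close> by (simp add: l_def)
  qed (auto simp: l_def)
  from openin_continuous_map_preimage[OF this W]
  have T: "openin (top_of_set S) {z \<in> S. l z \<in> W}" by simp
  have "z0 \<in> S" using t0 z0 torus_map_in_torus by (auto simp: S_def)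
  moreover have "l z0 = t0" using t0I z0 by (auto simp: l_def fun_eq_iff PiE_iff extensional_def)
  moreover have "torus_map I (l z) = z" if "z \<in> S" for z
  proof
    fix i
    show "torus_map I (l z) i = z i"
    proof (cases "i \<in> I")
      case True
      then have "cmod (z i) = 1" using that by (auto simp: S_def torus_def PiE_iff split: if_splits)
      then have "cis (Arg (z i / z0 i)) = z i / z0 i"
        using cis_Arg[of "z i / z0 i"] z0[OF True] by (cases "z i = 0") (auto simp: sgn_eq norm_divide)
      moreover have "cis (2 * pi * (t0 i + Arg (z i / z0 i) / (2 * pi))) = z0 i * cis (Arg (z i / z0 i))"
        using z0[OF True] by (simp add: distrib_left cis_mult)
      ultimately show ?thesis using True z0[OF True] by (simp add: torus_map_def l_def)
    next
      case False
      then show ?thesis using that by (auto simp: S_def torus_def torus_map_def PiE_iff split: if_splits)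
    qed
  qed
  then have "{z \<in> S. l z \<in> W} \<subseteq> torus_map I ` W" by (auto intro: rev_image_eqI)
  ultimately show "\<exists>T. openin (top_of_set (torus I)) T \<and> z0 \<in> T \<and> T \<subseteq> torus_map I ` W"
    using openin_trans[OF T S] t0 by (intro exI[of _ "{z \<in> S. l z \<in> W}"]) auto
qed

section \<open>Trigonometric polynomials in the angles and their density\<close>

inductive_set torus_poly :: "'i set \<Rightarrow> (('i \<Rightarrow> real) \<Rightarrow> complex) set" for I where
  mono: "(\<lambda>t. c * cis (2 * pi * (\<Sum>i\<in>I. of_int (k i) * t i))) \<in> torus_poly I"
| add: "p \<in> torus_poly I \<Longrightarrow> q \<in> torus_poly I \<Longrightarrow> (\<lambda>t. p t + q t) \<in> torus_poly I"

lemma torus_poly_const: "(\<lambda>_. c) \<in> torus_poly I"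
  using torus_poly.mono[of c "\<lambda>_. 0" I] by simp

lemma torus_poly_mult:
  assumes p: "p \<in> torus_poly I" and q: "q \<in> torus_poly I"
  shows "(\<lambda>t. p t * q t) \<in> torus_poly I"
  using p
proof induct
  case (mono c k)
  show ?case
    using q
  proof induct
    case (mono d l)
    have "(\<lambda>t. (c * d) * cis (2 * pi * (\<Sum>i\<in>I. of_int (k i + l i) * t i))) \<in> torus_poly I"
      by (rule torus_poly.mono)
    also have "(\<lambda>t. (c * d) * cis (2 * pi * (\<Sum>i\<in>I. of_int (k i + l i) * t i))) =
        (\<lambda>t. c * cis (2 * pi * (\<Sum>i\<in>I. of_int (k i) * t i)) * (d * cis (2 * pi * (\<Sum>i\<in>I. of_int (l i) * t i))))"
      by (simp add: fun_eq_iff distrib_right distrib_left sum.distrib cis_mult[symmetric])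
    finally show ?case .
  qed (simp add: distrib_left torus_poly.add)
qed (simp add: distrib_right torus_poly.add)

text \<open>The Stone-Weierstrass locale \<open>function_ring_on\<close> asks for an algebra of real
  functions; the real and imaginary parts of the coordinates separate the points of the
  torus.\<close>

inductive_set coord_ring :: "'i set \<Rightarrow> (('i \<Rightarrow> complex) \<Rightarrow> real) set" for I where
  const: "(\<lambda>_. c) \<in> coord_ring I"
| Re: "i \<in> I \<Longrightarrow> (\<lambda>z. Re (z i)) \<in> coord_ring I"
| Im: "i \<in> I \<Longrightarrow> (\<lambda>z. Im (z i)) \<in> coord_ring I"
| add: "f \<in> coord_ring I \<Longrightarrow> g \<in> coord_ring I \<Longrightarrow> (\<lambda>z. f z + g z) \<in> coord_ring I"
| mult: "f \<in> coord_ring I \<Longrightarrow> g \<in> coord_ring I \<Longrightarrow> (\<lambda>z. f z * g z) \<in> coord_ring I"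

lemma coord_ring_torus_poly:
  assumes I: "finite I" and "f \<in> coord_ring I"
  shows "(\<lambda>t. of_real (f (torus_map I t))) \<in> torus_poly I"
proof -
  \<comment> \<open>Cosine and sine of one angle combine the frequencies 1 and -1 in that
    coordinate.\<close>
  have single: "(\<lambda>t. c * cis (2 * pi * t i) + d * cis (- (2 * pi * t i))) \<in> torus_poly I"
    if "i \<in> I" for i c d
  proof -
    have "(\<Sum>j\<in>I. of_int (if j = i then k else 0) * t j) = of_int k * t i" for k and t :: "'a \<Rightarrow> real"
      using that I by (subst sum.mono_neutral_right[of I "{i}"]) auto
    then have "(\<lambda>t. c * cis (2 * pi * (of_int k * t i))) \<in> torus_poly I" for k c
      using torus_poly.mono[of c "\<lambda>j. if j = i then k else 0" I] by simp
    from torus_poly.add[OF this[of c 1] this[of d "-1"]] show ?thesis by simp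
  qed
  show ?thesis
    using assms(2)
  proof induct
    case (const c)
    show ?case by (rule torus_poly_const)
  next
    case (Re i)
    have *: "complex_of_real (cos x) = 1 / 2 * cis x + 1 / 2 * cis (- x)" for x
      by (simp add: complex_eq_iff)
    show ?case
      using single[OF Re, of "1 / 2" "1 / 2"] Re by (simp add: torus_map_def *)
  next
    case (Im i)
    have *: "complex_of_real (sin x) = - (\<i> / 2) * cis x + \<i> / 2 * cis (- x)" for x
      by (simp add: complex_eq_iff)
    show ?case
      using single[OF Im, of "- (\<i> / 2)" "\<i> / 2"] Im by (simp add: torus_map_def *)
  next
    case (add f g)
    then show ?case by (simp add: torus_poly.add)
  next
    case (mult f g)
    then show ?case by (simp add: torus_poly_mult)
  qed
qed

text \<open>Stone-Weierstrass bounds the error on the torus only, but \<open>torus_map I\<close>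
  takes all its values there, so the bound holds for every \<open>t\<close>, extensional or
  not.\<close>

lemma torus_poly_dense_real:
  fixes f :: "('i::countable \<Rightarrow> complex) \<Rightarrow> real"
  assumes I: "finite I" and f: "continuous_on (torus I) f" and e: "e > 0"
  shows "\<exists>p\<in>torus_poly I. \<forall>t. cmod (of_real (f (torus_map I t)) - p t) < e"
proof -
  interpret function_ring_on "coord_ring I" "torus I"
  proof
    show "compact (torus I)" by (rule compact_torus)
    show "continuous_on (torus I) f" if "f \<in> coord_ring I" for f
      using that
      by induct (auto intro!: continuous_intros continuous_on_subset[OF continuous_on_product_coordinates])
    fix x y assume "x \<in> torus I" "y \<in> torus I" "x \<noteq> y"
    then obtain i where "i \<in> I" "x i \<noteq> y i"
      by (auto simp: torus_def PiE_iff fun_eq_iff split: if_splits) metis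
    then show "\<exists>f\<in>coord_ring I. f x \<noteq> f y"
      using coord_ring.Re[OF \<open>i \<in> I\<close>] coord_ring.Im[OF \<open>i \<in> I\<close>] by (metis complex_eqI)
  qed (auto intro: coord_ring.intros)
  obtain g where g: "g \<in> coord_ring I" "\<forall>z\<in>torus I. \<bar>f z - g z\<bar> < e"
    using Stone_Weierstrass_basic[OF f e] by blast
  have "cmod (of_real (f (torus_map I t)) - of_real (g (torus_map I t))) < e" for t
    using g(2) torus_map_in_torus[of I t] by (metis norm_of_real of_real_diff)
  then show ?thesis using coord_ring_torus_poly[OF I g(1)] by (intro bexI) auto
qed

lemma torus_poly_dense:
  fixes f :: "('i::countable \<Rightarrow> complex) \<Rightarrow> complex"
  assumes I: "finite I" and f: "continuous_on (torus I) f" and e: "e > 0"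
  shows "\<exists>p\<in>torus_poly I. \<forall>t. cmod (f (torus_map I t) - p t) < e"
proof -
  have "continuous_on (torus I) (\<lambda>z. Re (f z))" "continuous_on (torus I) (\<lambda>z. Im (f z))"
    using f by (auto intro: continuous_intros)
  then obtain p q where p: "p \<in> torus_poly I" "\<And>t. cmod (of_real (Re (f (torus_map I t))) - p t) < e / 2"
    and q: "q \<in> torus_poly I" "\<And>t. cmod (of_real (Im (f (torus_map I t))) - q t) < e / 2"
    using torus_poly_dense_real[OF I _ half_gt_zero[OF e]] by meson
  have "cmod (f (torus_map I t) - (p t + \<i> * q t)) < e" for t
  proof -
    let ?w = "f (torus_map I t)"
    have "?w - (p t + \<i> * q t) = (of_real (Re ?w) - p t) + \<i> * (of_real (Im ?w) - q t)"
      using complex_eq[of ?w] by (simp add: algebra_simps)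
    also have "cmod \<dots> \<le> cmod (of_real (Re ?w) - p t) + cmod (of_real (Im ?w) - q t)"
      by (rule order_trans[OF norm_triangle_ineq]) (simp add: norm_mult)
    finally show ?thesis using p(2)[of t] q(2)[of t] by linarith
  qed
  moreover have "(\<lambda>t. p t + \<i> * q t) \<in> torus_poly I"
    by (intro torus_poly.add p torus_poly_mult torus_poly_const q)
  ultimately show ?thesis by (intro bexI) auto
qed

section \<open>Integration over the unit cube\<close>

lemma integral_cis_unit_interval:
  "has_bochner_integral lborel (\<lambda>t. indicator {0..1} t *\<^sub>R cis (2 * pi * (of_int k * t))) (if k = 0 then 1 else 0)"
proof (cases "k = 0")
  case True
  have "has_bochner_integral lborel (indicator {0..1::real} :: real \<Rightarrow> real) (measure lborel {0..1::real})"
    by (intro has_bochner_integral_real_indicator) auto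
  then have "has_bochner_integral lborel (\<lambda>t. indicator {0..1::real} t *\<^sub>R (1::complex)) (measure lborel {0..1::real} *\<^sub>R 1)"
    by (rule has_bochner_integral_scaleR_left[rotated])
  then show ?thesis using True by simp
next
  case False
  \<comment> \<open>This primitive has period 1, so its values at the two endpoints cancel.\<close>
  define F where "F t = cis (2 * pi * (of_int k * t)) / (\<i> * of_real (2 * pi * of_int k))" for t :: real
  have "has_bochner_integral lborel (\<lambda>t. indicator {0..1} t *\<^sub>R cis (2 * pi * (of_int k * t))) (F 1 - F 0)"
  proof (rule has_bochner_integral_FTC_Icc)
    fix x :: real
    have "((\<lambda>t. cis (2 * pi * (of_int k * t))) has_vector_derivative
       (2 * pi * of_int k) *\<^sub>R (\<i> * cis (2 * pi * (of_int k * x)))) (at x within {0..1})"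
    proof -
      have "((\<lambda>t. exp ((\<i> * of_real (2 * pi * of_int k)) * of_real t)) has_vector_derivative
        exp ((\<i> * of_real (2 * pi * of_int k)) * of_real x) * (\<i> * of_real (2 * pi * of_int k))) (at x within {0..1})"
        by (rule has_vector_derivative_real_field[of "\<lambda>z. exp ((\<i> * of_real (2 * pi * of_int k)) * z)"])
           (auto intro!: derivative_eq_intros)
      then show ?thesis by (simp add: cis_conv_exp scaleR_conv_of_real ac_simps)
    qed
    then have "(F has_vector_derivative
       (2 * pi * of_int k) *\<^sub>R (\<i> * cis (2 * pi * (of_int k * x))) / (\<i> * of_real (2 * pi * of_int k))) (at x within {0..1})"
      unfolding F_def by (rule has_vector_derivative_divide)
    then show "(F has_vector_derivative cis (2 * pi * (of_int k * x))) (at x within {0..1})"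
      using False by (simp add: scaleR_conv_of_real)
  qed (auto intro!: continuous_intros)
  moreover have "F 1 = F 0" by (simp add: F_def)
  ultimately show ?thesis using False by simp
qed

text \<open>The normalized Haar measure of the torus, read in the angles; the faces of the closed
  cube that the covering identifies form a null set.\<close>

definition unit_cube :: "'i set \<Rightarrow> ('i \<Rightarrow> real) measure" where
  "unit_cube I = restrict_space (PiM I (\<lambda>_. lborel)) (Pi\<^sub>E I (\<lambda>_. {0..1}))"

lemma cube_in_sets: "finite I \<Longrightarrow> Pi\<^sub>E I (\<lambda>_. {0..1}) \<inter> space (PiM I (\<lambda>_. lborel :: real measure)) \<in> sets (PiM I (\<lambda>_. lborel))"
  by (intro sets.Int sets_PiM_I_finite) auto

lemma emeasure_unit_cube:
  assumes "finite I" shows "emeasure (unit_cube I) (space (unit_cube I)) = 1"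
proof -
  interpret product_sigma_finite "\<lambda>_::'a. lborel :: real measure" by standard
  have "Pi\<^sub>E I (\<lambda>_. {0..1}) \<subseteq> space (PiM I (\<lambda>_. lborel :: real measure))"
    by (auto simp: space_PiM)
  then have "space (unit_cube I) = Pi\<^sub>E I (\<lambda>_. {0..1})"
    by (auto simp: unit_cube_def space_restrict_space)
  then show ?thesis
    unfolding unit_cube_def using assms cube_in_sets[OF assms]
    by (simp add: emeasure_restrict_space emeasure_PiM)
qed

lemma finite_measure_unit_cube: "finite I \<Longrightarrow> finite_measure (unit_cube I)"
  by standard (simp add: emeasure_unit_cube)

lemma measure_unit_cube [simp]: "finite I \<Longrightarrow> measure (unit_cube I) (space (unit_cube I)) = 1"
  by (simp add: measure_def emeasure_unit_cube)

lemma measurable_torus_map: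
  fixes I :: "'i::countable set"
  shows "torus_map I \<in> borel_measurable (unit_cube I)"
proof -
  have "torus_map I \<in> borel_measurable (PiM I (\<lambda>_. lborel))"
  proof (rule measurable_coordinatewise_then_product)
    fix i
    show "(\<lambda>t. torus_map I t i) \<in> borel_measurable (PiM I (\<lambda>_. lborel))"
    proof (cases "i \<in> I")
      case True
      have "(\<lambda>x. cis (2 * pi * x)) \<in> borel_measurable borel"
        by (intro borel_measurable_continuous_onI continuous_intros)
      moreover have "(\<lambda>t. t i) \<in> measurable (PiM I (\<lambda>_. lborel)) borel"
        using measurable_component_singleton[OF True, of "\<lambda>_. lborel"] by simp
      ultimately have "(\<lambda>t. cis (2 * pi * t i)) \<in> borel_measurable (PiM I (\<lambda>_. lborel))"
        by (rule measurable_compose[rotated])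
      then show ?thesis using True by (simp add: torus_map_def)
    qed (simp add: torus_map_def)
  qed
  then show ?thesis unfolding unit_cube_def by (rule measurable_restrict_space1)
qed

lemma has_bochner_integral_torus_mono:
  assumes I: "finite I"
  shows "has_bochner_integral (unit_cube I) (\<lambda>t. c * cis (2 * pi * (\<Sum>i\<in>I. of_int (k i) * t i)))
     (c * (if \<forall>i\<in>I. k i = 0 then 1 else 0))"
proof -
  interpret product_sigma_finite "\<lambda>_::'a. lborel :: real measure" by standard
  let ?f = "\<lambda>i t. indicator {0..1} t *\<^sub>R cis (2 * pi * (of_int (k i) * t))"
  have int: "integrable lborel (?f i)" "integral\<^sup>L lborel (?f i) = (if k i = 0 then 1 else 0)" for i
    using integral_cis_unit_interval[of "k i"] by (auto simp: has_bochner_integral_iff)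
  \<comment> \<open>Restricted to the space of the measure: \<open>Pi\<^sub>E\<close> also demands
    that \<open>t\<close> be undefined off \<open>I\<close>, which the product on the left cannot
    see.\<close>
  have *: "(\<Prod>i\<in>I. ?f i (t i)) = indicator (Pi\<^sub>E I (\<lambda>_. {0..1})) t *\<^sub>R cis (2 * pi * (\<Sum>i\<in>I. of_int (k i) * t i))"
    if "t \<in> space (PiM I (\<lambda>_. lborel))" for t
  proof -
    have "(\<Prod>i\<in>I. indicator {0..1} (t i)) = (indicator (Pi\<^sub>E I (\<lambda>_. {0..1})) t :: real)"
      using I that by (auto simp: indicator_def PiE_iff space_PiM)
    moreover have "(\<Prod>i\<in>I. cis (2 * pi * (of_int (k i) * t i))) = cis (2 * pi * (\<Sum>i\<in>I. of_int (k i) * t i))"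
      by (simp add: prod_cis sum_distrib_left)
    ultimately show ?thesis
      by (simp add: scaleR_conv_of_real prod.distrib of_real_prod[symmetric])
  qed
  have "has_bochner_integral (PiM I (\<lambda>_. lborel)) (\<lambda>t. \<Prod>i\<in>I. ?f i (t i)) (\<Prod>i\<in>I. if k i = 0 then 1 else 0)"
    using product_integrable_prod[OF I int(1)] product_integral_prod[OF I int(1)] int(2)
    by (simp add: has_bochner_integral_iff)
  also have "has_bochner_integral (PiM I (\<lambda>_. lborel)) (\<lambda>t. \<Prod>i\<in>I. ?f i (t i)) (\<Prod>i\<in>I. if k i = 0 then 1 else 0) =
    has_bochner_integral (PiM I (\<lambda>_. lborel)) (\<lambda>t. indicator (Pi\<^sub>E I (\<lambda>_. {0..1})) t *\<^sub>R cis (2 * pi * (\<Sum>i\<in>I. of_int (k i) * t i))) (\<Prod>i\<in>I. if k i = 0 then 1 else 0)"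
    by (rule has_bochner_integral_cong[OF refl *]) auto
  finally have "has_bochner_integral (unit_cube I) (\<lambda>t. cis (2 * pi * (\<Sum>i\<in>I. of_int (k i) * t i))) (\<Prod>i\<in>I. if k i = 0 then 1 else 0)"
    unfolding unit_cube_def using has_bochner_integral_restrict_space[OF cube_in_sets[OF I]] by blast
  moreover have "(\<Prod>i\<in>I. if k i = 0 then 1 else 0) = (if \<forall>i\<in>I. k i = 0 then 1 else (0::complex))"
    using I by auto
  ultimately have "has_bochner_integral (unit_cube I) (\<lambda>t. cis (2 * pi * (\<Sum>i\<in>I. of_int (k i) * t i)))
     (if \<forall>i\<in>I. k i = 0 then 1 else 0)" by (simp only:)
  then show ?thesis by (rule has_bochner_integral_mult_right)
qed

lemma torus_poly_integrable:
  assumes "finite I" "p \<in> torus_poly I"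
  shows "integrable (unit_cube I) p"
  using assms(2)
proof induct
  case (mono c k)
  show ?case using assms(1) has_bochner_integral_torus_mono[of I c k] by (auto simp: has_bochner_integral_iff)
qed auto

section \<open>Orbits of the lattice on the torus\<close>

definition row_span :: "'i set \<Rightarrow> ('i \<Rightarrow> real ^ 'n) \<Rightarrow> (real ^ 'n) set" where
  "row_span I \<Lambda> = {\<Sum>i\<in>I. of_int (k i) *\<^sub>R \<Lambda> i | k :: 'i \<Rightarrow> int. True}"

text \<open>Nonresonance with denominators cleared and the identity rows moved to the other side:
  along the orbit, only the trivial character of the torus becomes constant.\<close>

definition integrally_nonresonant :: "'i set \<Rightarrow> ('i \<Rightarrow> real ^ 'n) \<Rightarrow> bool" where
  "integrally_nonresonant I \<Lambda> \<longleftrightarrow>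
     (\<forall>k :: 'i \<Rightarrow> int. (\<Sum>i\<in>I. of_int (k i) *\<^sub>R \<Lambda> i) \<in> int_vecs \<longrightarrow> (\<forall>i\<in>I. k i = 0))"

definition lattice_orbit :: "'i set \<Rightarrow> ('i \<Rightarrow> real ^ 'n) \<Rightarrow> int ^ 'n \<Rightarrow> 'i \<Rightarrow> real" where
  "lattice_orbit I \<Lambda> x = (\<lambda>i\<in>I. \<Lambda> i \<bullet> of_int_vec x)"

lemma torus_mono_orbit:
  "cis (2 * pi * (\<Sum>i\<in>I. of_int (k i) * lattice_orbit I \<Lambda> x i)) = lattice_char (\<Sum>i\<in>I. of_int (k i) *\<^sub>R \<Lambda> i) x"
  by (simp add: lattice_char_def lattice_orbit_def inner_sum_left)

lemma torus_poly_orbit_trig: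
  "p \<in> torus_poly I \<Longrightarrow> (\<lambda>x. p (lattice_orbit I \<Lambda> x)) \<in> trig (row_span I \<Lambda>)"
proof (induct rule: torus_poly.induct)
  case (mono c k)
  show ?case unfolding torus_mono_orbit by (rule trig.mono) (auto simp: row_span_def)
qed (rule trig.add)

text \<open>Weyl's criterion: both sides are linear in \<open>p\<close>, and a monomial restricts to
  a lattice character whose frequency is integral only for zero exponents.\<close>

lemma torus_poly_orbit_has_mean:
  assumes I: "finite I" and \<Lambda>: "integrally_nonresonant I \<Lambda>" and p: "p \<in> torus_poly I"
  shows "has_mean (\<lambda>x. p (lattice_orbit I \<Lambda> x)) (integral\<^sup>L (unit_cube I) p)"
  using p
proof induct
  case (mono c k)
  let ?\<theta> = "\<Sum>i\<in>I. of_int (k i) *\<^sub>R \<Lambda> i"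
  have "?\<theta> \<in> int_vecs \<longleftrightarrow> (\<forall>i\<in>I. k i = 0)"
  proof
    assume "\<forall>i\<in>I. k i = 0"
    then have "?\<theta> = 0" by simp
    then show "?\<theta> \<in> int_vecs" by (simp only: int_vecs_iff) simp
  qed (use \<Lambda> in \<open>auto simp: integrally_nonresonant_def\<close>)
  then show ?case
    unfolding torus_mono_orbit has_bochner_integral_integral_eq[OF has_bochner_integral_torus_mono[OF I]]
    using has_mean_cmult[OF has_mean_lattice_char[of ?\<theta>], of c] by simp
next
  case (add p q)
  then show ?case
    using has_mean_add torus_poly_integrable[OF I] by (simp add: has_mean_add)
qed

text \<open>It is checked on products of measurable sets, where it is translation invariance in each
  coordinate.\<close>

lemma PiM_lborel_translate:
  fixes a :: "'i \<Rightarrow> real"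
  assumes I: "finite I"
  shows "distr (PiM I (\<lambda>_. lborel)) (PiM I (\<lambda>_. lborel)) (\<lambda>t. \<lambda>i\<in>I. t i + a i) = PiM I (\<lambda>_. lborel)"
proof -
  interpret product_sigma_finite "\<lambda>_::'i. lborel :: real measure" by standard
  have meas: "(\<lambda>t. \<lambda>i\<in>I. t i + a i) \<in> measurable (PiM I (\<lambda>_. lborel)) (PiM I (\<lambda>_. lborel))"
    by measurable
  show ?thesis
  proof (rule PiM_eqI[OF I])
    fix A :: "'i \<Rightarrow> real set" assume A: "\<And>i. i \<in> I \<Longrightarrow> A i \<in> sets lborel"
    have *: "emeasure lborel ((\<lambda>s. a i + s) -` A i) = emeasure lborel (A i)"
      "(\<lambda>s. a i + s) -` A i \<in> sets lborel" if "i \<in> I" for i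
    proof -
      have m: "(+) (a i) \<in> measurable lborel borel" by simp
      have "emeasure (distr lborel borel ((+) (a i))) (A i) = emeasure lborel ((+) (a i) -` A i)"
        using A[OF that] m by (simp add: emeasure_distr)
      then show "emeasure lborel ((\<lambda>s. a i + s) -` A i) = emeasure lborel (A i)"
        by (simp add: lborel_distr_plus)
      show "(\<lambda>s. a i + s) -` A i \<in> sets lborel" using measurable_sets[OF m, of "A i"] A[OF that] by simp
    qed
    have "(\<lambda>t. \<lambda>i\<in>I. t i + a i) -` Pi\<^sub>E I A \<inter> space (PiM I (\<lambda>_. lborel)) = Pi\<^sub>E I (\<lambda>i. (\<lambda>s. a i + s) -` A i)"
      by (auto simp: space_PiM PiE_iff add.commute)
    then show "emeasure (distr (PiM I (\<lambda>_. lborel)) (PiM I (\<lambda>_. lborel)) (\<lambda>t. \<lambda>i\<in>I. t i + a i)) (Pi\<^sub>E I A)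
      = (\<Prod>i\<in>I. emeasure lborel (A i))"
      using * A I by (simp add: emeasure_distr[OF meas] sets_PiM_I_finite emeasure_PiM)
  qed simp
qed

text \<open>The points over the image of \<open>K\<close> form the union of the translates of
  \<open>K\<close> by integer vectors. These are countably many since \<open>I\<close> is finite,
  and translation preserves null sets.\<close>

lemma null_sets_torus_saturation:
  assumes I: "finite I" and K: "K \<in> null_sets (PiM I (\<lambda>_. lborel))" "K \<subseteq> Pi\<^sub>E I (\<lambda>_. UNIV)"
  shows "{t \<in> Pi\<^sub>E I (\<lambda>_. UNIV). torus_map I t \<in> torus_map I ` K} \<in> null_sets (PiM I (\<lambda>_. lborel))"
proof -
  let ?M = "PiM I (\<lambda>_. lborel :: real measure)"
  have "{t \<in> Pi\<^sub>E I (\<lambda>_. UNIV). torus_map I t \<in> torus_map I ` K}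
    = (\<Union>a\<in>Pi\<^sub>E I (\<lambda>_. \<int>). (\<lambda>t. \<lambda>i\<in>I. t i + a i) -` K \<inter> space ?M)" (is "?L = ?R")
  proof (intro subset_antisym subsetI)
    fix t assume "t \<in> ?L"
    then obtain s where t: "t \<in> Pi\<^sub>E I (\<lambda>_. UNIV)" and s: "s \<in> K" "torus_map I s = torus_map I t"
      by (metis (mono_tags, lifting) imageE mem_Collect_eq)
    then have "\<forall>i\<in>I. s i - t i \<in> \<int>" by (simp add: torus_map_eq_iff)
    moreover have "(\<lambda>i\<in>I. t i + (\<lambda>i\<in>I. s i - t i) i) = s"
      using s(1) K(2) by (auto simp: fun_eq_iff PiE_iff extensional_def)
    ultimately show "t \<in> ?R"
      using t s(1) by (intro UN_I[of "\<lambda>i\<in>I. s i - t i"]) (auto simp: space_PiM simp del: restrict_apply)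
  next
    fix t assume "t \<in> ?R"
    then obtain a where a: "a \<in> Pi\<^sub>E I (\<lambda>_. \<int>)" "(\<lambda>i\<in>I. t i + a i) \<in> K" and t: "t \<in> space ?M" by auto
    then have "torus_map I t = torus_map I (\<lambda>i\<in>I. t i + a i)"
      by (subst torus_map_eq_iff) (auto simp: PiE_iff)
    then have "torus_map I t \<in> torus_map I ` K" using a(2) by (rule image_eqI)
    then show "t \<in> ?L" using t by (auto simp: space_PiM)
  qed
  also have "\<dots> \<in> null_sets ?M"
  proof (rule null_sets_UN')
    show "countable (Pi\<^sub>E I (\<lambda>_. \<int> :: real set))"
      using I by (intro countable_PiE) (auto simp: Ints_def)
    fix a :: "'a \<Rightarrow> real"
    have meas: "(\<lambda>t. \<lambda>i\<in>I. t i + a i) \<in> measurable ?M ?M" by measurable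
    have "K \<in> null_sets (distr ?M ?M (\<lambda>t. \<lambda>i\<in>I. t i + a i))"
      using K(1) by (simp only: PiM_lborel_translate[OF I])
    then show "(\<lambda>t. \<lambda>i\<in>I. t i + a i) -` K \<inter> space ?M \<in> null_sets ?M"
      by (simp only: null_sets_distr_iff[OF meas])
  qed
  finally show ?thesis .
qed

section \<open>Equidistribution\<close>

text \<open>
  Multiplying by a continuous cutoff that vanishes on the image of \<open>K\<close> makes \<open>f\<close> continuous on the
  torus; the error is bounded by the complementary cutoff, whose integral tends to 0.
\<close>

lemma trig_approximable_orbit:
  fixes I :: "'i::countable set" and f :: "('i \<Rightarrow> real) \<Rightarrow> complex"
  assumes I: "finite I" and \<Lambda>: "integrally_nonresonant I \<Lambda>"
    and K: "compactin (product_topology (\<lambda>_. euclideanreal) I) K" "K \<in> null_sets (PiM I (\<lambda>_. lborel))"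
    and periodic: "\<And>s t. s \<in> Pi\<^sub>E I (\<lambda>_. UNIV) \<Longrightarrow> t \<in> Pi\<^sub>E I (\<lambda>_. UNIV) \<Longrightarrow>
      torus_map I s = torus_map I t \<Longrightarrow> f s = f t"
    and bounded: "\<And>t. cmod (f t) \<le> 1"
    and cont: "\<And>t \<epsilon>. t \<in> Pi\<^sub>E I (\<lambda>_. UNIV) \<Longrightarrow> torus_map I t \<notin> torus_map I ` K \<Longrightarrow> \<epsilon> > 0 \<Longrightarrow>
      \<exists>W. openin (product_topology (\<lambda>_. euclideanreal) I) W \<and> t \<in> W \<and> (\<forall>s\<in>W. cmod (f s - f t) < \<epsilon>)"
  shows "trig_approximable (row_span I \<Lambda>) (\<lambda>x. f (lattice_orbit I \<Lambda> x))"
proof -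
  define D where "D = torus_map I ` K"
  define M where "M = unit_cube I"
  have M: "finite_measure M" "measure M (space M) = 1" using finite_measure_unit_cube[OF I] I by (auto simp: M_def)
  have KI: "K \<subseteq> Pi\<^sub>E I (\<lambda>_. UNIV)" using compactin_subset_topspace[OF K(1)] by simp
  have "closed D"
    using image_compactin[OF K(1) continuous_map_torus_map] unfolding D_def by (simp add: compact_imp_closed)

  \<comment> \<open>\<open>f\<close> descends to the torus; periodicity makes the chosen
    representative immaterial.\<close>
  define F where "F z = f (SOME t. t \<in> Pi\<^sub>E I (\<lambda>_. UNIV) \<and> torus_map I t = z)" for z
  have F_eq: "F (torus_map I t) = f t" if "t \<in> Pi\<^sub>E I (\<lambda>_. UNIV)" for t
    using someI[of "\<lambda>s. s \<in> Pi\<^sub>E I (\<lambda>_. UNIV) \<and> torus_map I s = torus_map I t" t] that periodic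
    unfolding F_def by blast
  have F_bound: "cmod (F z) \<le> 1" for z unfolding F_def by (rule bounded)
  \<comment> \<open>Continuity descends too, because the covering map is open and turns the
    neighbourhood \<open>W\<close> of \<open>t\<close> into one of \<open>z\<close>.\<close>
  have F_cont: "continuous (at z within torus I) F" if z: "z \<in> torus I" "z \<notin> D" for z
    unfolding continuous_within
  proof (rule tendstoI)
    fix e :: real assume "e > 0"
    obtain t where t: "t \<in> Pi\<^sub>E I (\<lambda>_. UNIV)" "torus_map I t = z" by (rule torus_map_surj[OF z(1)])
    obtain W where W: "openin (product_topology (\<lambda>_. euclideanreal) I) W" "t \<in> W" "\<forall>s\<in>W. cmod (f s - f t) < e"
      using cont[OF t(1) _ \<open>e > 0\<close>] z(2) unfolding t(2) D_def by meson
    obtain O' where O': "open O'" "torus_map I ` W = torus I \<inter> O'"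
      using openin_torus_map_image[OF I W(1)] unfolding openin_open by blast
    have "dist (F y) (F z) < e" if "y \<in> torus I" "y \<in> O'" for y
    proof -
      have "y \<in> torus_map I ` W" using that unfolding O'(2) by simp
      then obtain s where s: "s \<in> W" "y = torus_map I s" by (rule imageE)
      have "s \<in> topspace (product_topology (\<lambda>_. euclideanreal) I)"
        using openin_subset[OF W(1)] s(1) by (rule subsetD)
      then have sI: "s \<in> Pi\<^sub>E I (\<lambda>_. UNIV)" by simp
      have "F y = f s" "F z = f t" using F_eq[OF sI] F_eq[OF t(1)] s(2) t(2) by simp_all
      then show ?thesis using s(1) W(3) by (simp add: dist_norm)
    qed
    moreover have "z \<in> O'" using imageI[OF W(2), of "torus_map I"] unfolding O'(2) t(2) by simp
    ultimately show "\<forall>\<^sub>F y in at z within torus I. dist (F y) (F z) < e"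
      using O'(1) unfolding eventually_at_topological by blast
  qed

  \<comment> \<open>A cutoff equal to 1 on \<open>D\<close> and, for \<open>n > 0\<close>, to 0 at
    distance \<open>1 / n\<close> and beyond. The empty \<open>D\<close> is treated apart:
    \<open>infdist\<close> to the empty set is 0 by convention, and the formula would give 1
    everywhere.\<close>
  define h where "h n z = (if D = {} then 0 else max 0 (1 - real n * infdist z D))" for n z
  have h_cont: "continuous_on A (h n)" for n A
    unfolding h_def by (cases "D = {}") (auto intro!: continuous_intros)
  have h_range: "0 \<le> h n z" "h n z \<le> 1" for n z
    by (auto simp: h_def infdist_nonneg)
  have h_D: "h n z = 1" if "z \<in> D" for n z using that by (auto simp: h_def)
  have h_tendsto: "(\<lambda>n. h n z) \<longlonglongrightarrow> 0" if "z \<notin> D" for z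
  proof (cases "D = {}")
    case False
    then have pos: "infdist z D > 0" using infdist_pos_not_in_closed[OF \<open>closed D\<close>] that by blast
    obtain N where N: "real N * infdist z D > 1" using reals_Archimedean3[OF pos] by blast
    have "h n z = 0" if "n \<ge> N" for n
    proof -
      have "real N * infdist z D \<le> real n * infdist z D" using that pos by (intro mult_right_mono) auto
      then show ?thesis using N False by (simp add: h_def)
    qed
    then show ?thesis by (intro tendsto_eventually) (auto simp: eventually_sequentially)
  qed (simp add: h_def)

  define G where "G n z = of_real (1 - h n z) * F z" for n z
  have G_cont: "continuous_on (torus I) (G n)" for n
    unfolding continuous_on_eq_continuous_within
  proof
    fix z assume z: "z \<in> torus I"
    have hc: "continuous (at z within torus I) (h n)"
      using h_cont[of "torus I" n] z by (simp add: continuous_on_eq_continuous_within)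
    show "continuous (at z within torus I) (G n)"
    proof (cases "z \<in> D")
      case True
      \<comment> \<open>Here \<open>F\<close> may jump, but it is bounded and the factor
        \<open>1 - h n\<close> tends to 0.\<close>
      have "((\<lambda>y. 1 - h n y) \<longlongrightarrow> 1 - h n z) (at z within torus I)"
        using hc unfolding continuous_within by (intro tendsto_intros)
      then have lim: "((\<lambda>y. 1 - h n y) \<longlongrightarrow> 0) (at z within torus I)" using h_D[OF True] by simp
      have "cmod (G n y) \<le> 1 - h n y" for y
      proof -
        have "cmod (G n y) = (1 - h n y) * cmod (F y)"
          using h_range[where n = n and z = y] by (simp add: G_def norm_mult del: of_real_diff)
        then show ?thesis using F_bound[of y] h_range[where n = n and z = y] by (simp add: mult_left_le)
      qed
      then have "(G n \<longlongrightarrow> 0) (at z within torus I)"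
        by (intro Lim_null_comparison[OF _ lim]) auto
      moreover have "G n z = 0" using h_D[OF True] by (simp add: G_def)
      ultimately show ?thesis by (simp add: continuous_within)
    next
      case False
      then show ?thesis unfolding G_def using hc F_cont[OF z False] by (intro continuous_intros)
    qed
  qed

  have h_meas: "(\<lambda>t. h n (torus_map I t)) \<in> borel_measurable M" for n
    using measurable_compose[OF measurable_torus_map borel_measurable_continuous_onI[OF h_cont]]
    unfolding M_def .
  have h_int: "integrable M (\<lambda>t. h n (torus_map I t))" for n
    using h_range by (intro finite_measure.integrable_const_bound[OF M(1), of _ 1] h_meas) auto
  \<comment> \<open>The whole preimage of \<open>D\<close> must be null, not just \<open>K\<close>:
    the unit cube may meet other translates of \<open>K\<close>.\<close>
  have "AE t in PiM I (\<lambda>_. lborel). torus_map I t \<notin> D"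
    by (rule AE_I'[OF null_sets_torus_saturation[OF I K(2) KI]]) (auto simp: D_def space_PiM)
  then have "AE t in M. torus_map I t \<notin> D"
    unfolding M_def unit_cube_def AE_restrict_space_iff[OF cube_in_sets[OF I]] by eventually_elim auto
  then have AE_lim: "AE t in M. (\<lambda>n. h n (torus_map I t)) \<longlonglongrightarrow> 0"
    by eventually_elim (rule h_tendsto)
  have "(\<lambda>n. \<integral>t. h n (torus_map I t) \<partial>M) \<longlonglongrightarrow> (\<integral>t. 0 \<partial>M)"
    using h_range
    by (intro integral_dominated_convergence[where w = "\<lambda>_. 1"] h_meas AE_lim
        finite_measure.integrable_const[OF M(1)]) auto
  then have h_lim: "(\<lambda>n. \<integral>t. h n (torus_map I t) \<partial>M) \<longlonglongrightarrow> 0" by simp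

  show ?thesis
    unfolding trig_approximable_def
  proof (intro allI impI)
    fix \<epsilon> :: real assume e: "\<epsilon> > 0"
    then have e4: "\<epsilon> / 4 > 0" by simp
    obtain n where n: "(\<integral>t. h n (torus_map I t) \<partial>M) < \<epsilon> / 4"
      using order_tendstoD(2)[OF h_lim e4] by (auto simp: eventually_sequentially)
    obtain p where p: "p \<in> torus_poly I" "\<And>t. cmod (G n (torus_map I t) - p t) < \<epsilon> / 4"
      using torus_poly_dense[OF I G_cont e4] by blast
    obtain q0 where q0: "q0 \<in> torus_poly I" "\<And>t. cmod (of_real (h n (torus_map I t)) - q0 t) < \<epsilon> / 4"
      using torus_poly_dense_real[OF I h_cont e4] by blast
    \<comment> \<open>The shift pays \<open>\<epsilon> / 4\<close> twice, for \<open>q0\<close>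
      falling below the cutoff and for \<open>p\<close> missing \<open>G n\<close>. The integral of
      \<open>Re (q t)\<close> then exceeds that of the cutoff by at most
      \<open>3 * \<epsilon> / 4\<close>.\<close>
    define q where "q t = q0 t + of_real (\<epsilon> / 2)" for t
    have q: "q \<in> torus_poly I" unfolding q_def by (intro torus_poly.add q0 torus_poly_const)
    have q0h: "\<bar>h n (torus_map I t) - Re (q0 t)\<bar> < \<epsilon> / 4" for t
      using abs_Re_le_cmod[of "of_real (h n (torus_map I t)) - q0 t"] q0(2)[of t] by simp
    have le: "cmod (f t - p t) \<le> Re (q t)" if "t \<in> Pi\<^sub>E I (\<lambda>_. UNIV)" for t
    proof -
      have "f t - G n (torus_map I t) = of_real (h n (torus_map I t)) * f t"
        by (simp add: G_def F_eq[OF that] algebra_simps)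
      then have "cmod (f t - G n (torus_map I t)) \<le> h n (torus_map I t)"
        using bounded[of t] h_range[where n = n and z = "torus_map I t"]
        by (simp add: norm_mult mult_left_le)
      moreover have "cmod (f t - p t) \<le> cmod (f t - G n (torus_map I t)) + cmod (G n (torus_map I t) - p t)"
        using norm_triangle_ineq[of "f t - G n (torus_map I t)" "G n (torus_map I t) - p t"] by simp
      moreover have "h n (torus_map I t) < Re (q0 t) + \<epsilon> / 4"
        using q0h[of t] unfolding abs_less_iff by linarith
      moreover have "Re (q t) = Re (q0 t) + \<epsilon> / 2" by (simp add: q_def)
      ultimately show ?thesis using p(2)[of t] by linarith
    qed
    have "Re (integral\<^sup>L M q) = (\<integral>t. Re (q t) \<partial>M)"
      using torus_poly_integrable[OF I q] by (simp add: M_def)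
    also have "\<dots> \<le> (\<integral>t. h n (torus_map I t) + 3 * \<epsilon> / 4 \<partial>M)"
    proof (rule integral_mono)
      show "integrable M (\<lambda>t. Re (q t))" using torus_poly_integrable[OF I q] by (simp add: M_def)
      show "integrable M (\<lambda>t. h n (torus_map I t) + 3 * \<epsilon> / 4)"
        by (intro Bochner_Integration.integrable_add h_int finite_measure.integrable_const[OF M(1)])
      fix t
      have "Re (q t) = Re (q0 t) + \<epsilon> / 2" by (simp add: q_def)
      then show "Re (q t) \<le> h n (torus_map I t) + 3 * \<epsilon> / 4"
        using q0h[of t] unfolding abs_less_iff by linarith
    qed
    also have "\<dots> = (\<integral>t. h n (torus_map I t) \<partial>M) + 3 * \<epsilon> / 4"
      using h_int[of n] finite_measure.integrable_const[OF M(1)] M(2)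
      by (subst Bochner_Integration.integral_add) auto
    finally have small: "Re (integral\<^sup>L M q) < \<epsilon>" using n by linarith
    show "\<exists>p\<in>trig (row_span I \<Lambda>). \<exists>q\<in>trig (row_span I \<Lambda>). \<exists>d.
       (\<forall>x. cmod (f (lattice_orbit I \<Lambda> x) - p x) \<le> Re (q x)) \<and> has_mean q d \<and> Re d < \<epsilon>"
      using torus_poly_orbit_has_mean[OF I \<Lambda> q] small le
      by (intro bexI[OF _ torus_poly_orbit_trig[OF p(1)]] bexI[OF _ torus_poly_orbit_trig[OF q]]
          exI[of _ "integral\<^sup>L M q"]) (auto simp: M_def lattice_orbit_def)
  qed
qed

text \<open>Modulo 1, membership in \<open>A\<close> says that the orbit point lies in the image of
  \<open>G\<close> on the torus, and the indicator of that image is continuous except over the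
  frontier of \<open>G\<close>, a compact null set.\<close>

lemma quasiperiodic_trig_approximable:
  assumes \<Lambda>: "integrally_nonresonant {..<m} \<Lambda>" and A: "A \<in> Q_fin m \<Lambda>"
  shows "trig_approximable (row_span {..<m} \<Lambda>) (\<lambda>x. of_bool (x \<in> A))"
proof -
  let ?I = "{..<m}"
  let ?X = "product_topology (\<lambda>_. euclideanreal) ?I"
  obtain G where G: "A = Q_set m G \<Lambda>" "G \<subseteq> Pi\<^sub>E ?I (\<lambda>_. {0..<1})" "jordan_measurable_dim m G"
    using A by (auto simp: Q_fin_def)
  define K where "K = ?X frontier_of G"
  define f :: "(nat \<Rightarrow> real) \<Rightarrow> complex" where "f t = of_bool (torus_map ?I t \<in> torus_map ?I ` G)" for t
  have cube: "compactin ?X (Pi\<^sub>E ?I (\<lambda>_. {0..1}))" "closedin ?X (Pi\<^sub>E ?I (\<lambda>_. {0..1}))"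
    by (auto simp: compactin_PiE closedin_product_topology)
  have GX: "G \<subseteq> topspace ?X" using G(2) by auto
  have "G \<subseteq> Pi\<^sub>E ?I (\<lambda>_. {0..1})"
    using G(2) by (rule order_trans) (intro PiE_mono, auto)
  then have "?X closure_of G \<subseteq> Pi\<^sub>E ?I (\<lambda>_. {0..1})" by (rule closure_of_minimal[OF _ cube(2)])
  then have cl: "compactin ?X (?X closure_of G)"
    by (rule closed_compactin[OF cube(1)]) simp
  have K_comp: "compactin ?X K"
  proof (rule closed_compactin[OF cl])
    show "K \<subseteq> ?X closure_of G" unfolding K_def frontier_of_def by blast
    show "closedin ?X K" unfolding K_def by (rule closedin_frontier_of)
  qed
  have K_null: "K \<in> null_sets (PiM ?I (\<lambda>_. lborel))"
    using G(3) unfolding jordan_measurable_dim_def K_def by blast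
  have "closed (torus_map ?I ` (?X closure_of G))"
    using image_compactin[OF cl continuous_map_torus_map] by (simp add: compact_imp_closed)
  then have cl_open: "openin ?X {s \<in> topspace ?X. torus_map ?I s \<in> - (torus_map ?I ` (?X closure_of G))}"
    by (intro openin_continuous_map_preimage[OF continuous_map_torus_map]) auto
  obtain O' where O': "open O'" "torus_map ?I ` (?X interior_of G) = torus ?I \<inter> O'"
    using openin_torus_map_image[of ?I "?X interior_of G"] unfolding openin_open by auto
  have int_open: "openin ?X {s \<in> topspace ?X. torus_map ?I s \<in> O'}"
    using O'(1) by (intro openin_continuous_map_preimage[OF continuous_map_torus_map]) auto
  have "trig_approximable (row_span ?I \<Lambda>) (\<lambda>x. f (lattice_orbit ?I \<Lambda> x))"
  proof (rule trig_approximable_orbit[OF _ \<Lambda> K_comp K_null])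
    fix t :: "nat \<Rightarrow> real" and \<epsilon> :: real
    assume t: "t \<in> Pi\<^sub>E ?I (\<lambda>_. UNIV)" "torus_map ?I t \<notin> torus_map ?I ` K" and "\<epsilon> > 0"
    \<comment> \<open>Two cases remain off the image of the frontier. The image of the interior is
      open, so \<open>f\<close> is 1 nearby; the image of the closure is compact, so its complement
      is open and \<open>f\<close> is 0 there.\<close>
    have "?X closure_of G \<subseteq> ?X interior_of G \<union> K" by (auto simp: K_def frontier_of_def)
    then consider "torus_map ?I t \<in> torus_map ?I ` (?X interior_of G)"
      | "torus_map ?I t \<notin> torus_map ?I ` (?X closure_of G)"
      using t(2) by blast
    then show "\<exists>W. openin ?X W \<and> t \<in> W \<and> (\<forall>s\<in>W. cmod (f s - f t) < \<epsilon>)"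
    proof cases
      case 1
      have "torus_map ?I ` (?X interior_of G) \<subseteq> torus_map ?I ` G" by (intro image_mono interior_of_subset)
      then have "f s = 1" if "torus_map ?I s \<in> O'" for s
        using O'(2) that torus_map_in_torus[of ?I s] by (auto simp: f_def)
      then show ?thesis using int_open 1 t(1) O'(2) \<open>\<epsilon> > 0\<close>
        by (intro exI[of _ "{s \<in> topspace ?X. torus_map ?I s \<in> O'}"]) auto
    next
      case 2
      have "torus_map ?I ` G \<subseteq> torus_map ?I ` (?X closure_of G)"
        by (intro image_mono closure_of_subset[OF GX])
      then have "f s = 0" if "torus_map ?I s \<notin> torus_map ?I ` (?X closure_of G)" for s
        using that by (auto simp: f_def)
      then show ?thesis using cl_open 2 t(1) \<open>\<epsilon> > 0\<close>
        by (intro exI[of _ "{s \<in> topspace ?X. torus_map ?I s \<in> - (torus_map ?I ` (?X closure_of G))}"]) auto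
    qed
  qed (auto simp: f_def)
  moreover have "f (lattice_orbit ?I \<Lambda> x) = of_bool (x \<in> A)" for x
  proof -
    have "torus_map ?I (lattice_orbit ?I \<Lambda> x) = torus_map ?I g \<longleftrightarrow>
      (\<exists>z :: nat \<Rightarrow> int. \<forall>i<m. \<Lambda> i \<bullet> of_int_vec x = g i + real_of_int (z i))" for g
    proof
      assume "torus_map ?I (lattice_orbit ?I \<Lambda> x) = torus_map ?I g"
      then have "\<forall>i<m. \<Lambda> i \<bullet> of_int_vec x - g i \<in> \<int>" by (simp add: torus_map_eq_iff lattice_orbit_def)
      then have "\<forall>i<m. \<Lambda> i \<bullet> of_int_vec x = g i + real_of_int \<lfloor>\<Lambda> i \<bullet> of_int_vec x - g i\<rfloor>" by auto
      then show "\<exists>z :: nat \<Rightarrow> int. \<forall>i<m. \<Lambda> i \<bullet> of_int_vec x = g i + real_of_int (z i)"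
        by (rule exI[of _ "\<lambda>i. \<lfloor>\<Lambda> i \<bullet> of_int_vec x - g i\<rfloor>"])
    qed (auto simp: torus_map_eq_iff lattice_orbit_def)
    then have "torus_map ?I (lattice_orbit ?I \<Lambda> x) \<in> torus_map ?I ` G \<longleftrightarrow> x \<in> A"
      unfolding G(1) Q_set_def image_iff by simp
    then show ?thesis by (simp add: f_def)
  qed
  ultimately show ?thesis by simp
qed

section \<open>The quantization error as a function on the torus\<close>

lemma measurable_vec_lambda_lborel:
  "(\<lambda>t. \<chi> j. t j) \<in> measurable (PiM UNIV (\<lambda>_. lborel)) (borel :: (real ^ 'n) measure)"
proof (subst borel_measurable_euclidean_space, intro ballI)
  fix b :: "real ^ 'n" assume "b \<in> Basis"
  then obtain i where "b = axis i 1" by (auto simp: Basis_vec_def)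
  then have "(\<lambda>t. (\<chi> j. t j) \<bullet> b) = (\<lambda>t. t i)" by (simp add: fun_eq_iff inner_axis)
  then show "(\<lambda>t. (\<chi> j. t j) \<bullet> b) \<in> borel_measurable (PiM UNIV (\<lambda>_. lborel))"
    using measurable_component_singleton[of i UNIV "\<lambda>_. lborel :: real measure"] by simp
qed

text \<open>This transports null sets from the vector type, on which the quantizer is given, to the
  product measure used for the torus.\<close>

lemma distr_vec_lambda_lborel:
  "distr (PiM UNIV (\<lambda>_. lborel)) borel (\<lambda>t. \<chi> j. t j) = (lborel :: (real ^ 'n) measure)"
proof (rule lborel_eqI[symmetric])
  interpret product_sigma_finite "\<lambda>_::'n. lborel :: real measure" by standard
  let ?v = "\<lambda>t. (\<chi> j. t j) :: real ^ 'n"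
  fix l u :: "real ^ 'n" assume lu: "\<And>b. b \<in> Basis \<Longrightarrow> l \<bullet> b \<le> u \<bullet> b"
  have le: "l $ j \<le> u $ j" for j
    using lu[of "axis j 1"] by (simp add: inner_axis axis_in_Basis_iff)
  have "?v -` box l u \<inter> space (PiM UNIV (\<lambda>_. lborel)) = Pi\<^sub>E UNIV (\<lambda>j. {l $ j<..<u $ j})"
    by (auto simp: space_PiM mem_box_cart PiE_iff)
  then have "emeasure (distr (PiM UNIV (\<lambda>_. lborel)) borel ?v) (box l u) = (\<Prod>j\<in>UNIV. ennreal (u $ j - l $ j))"
    using le by (simp add: emeasure_distr[OF measurable_vec_lambda_lborel] emeasure_PiM)
  also have "\<dots> = ennreal (\<Prod>j\<in>UNIV. u $ j - l $ j)" using le by (simp add: prod_ennreal)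
  also have "(\<Prod>j\<in>UNIV. u $ j - l $ j) = (\<Prod>b\<in>Basis. (u - l) \<bullet> b)"
  proof -
    have "bij_betw (\<lambda>j. axis j 1) UNIV (Basis :: (real ^ 'n) set)"
      by (auto simp: bij_betw_def inj_on_def axis_eq_axis Basis_vec_def)
    from prod.reindex_bij_betw[OF this, of "\<lambda>b. (u - l) \<bullet> b"] show ?thesis
      by (simp add: inner_axis)
  qed
  finally show "emeasure (distr (PiM UNIV (\<lambda>_. lborel)) borel ?v) (box l u) = (\<Prod>b\<in>Basis. (u - l) \<bullet> b)" .
qed simp


text \<open>By equivariance of \<open>R\<close> the error \<open>R u - u\<close> is periodic under
  the lattice. On each lattice translate of the interior of the cell \<open>\<Omega>\<close> the map
  \<open>R\<close> is constant, so jumps occur only over the frontier of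
  \<open>\<Omega>\<close>.\<close>

lemma quantization_error_trig_approximable:
  fixes R :: "real ^ 'n \<Rightarrow> int ^ 'n" and L :: "real ^ 'n ^ 'n"
  assumes R: "quantizer R" and L: "integrally_nonresonant UNIV (\<lambda>j. row j L)"
  shows "trig_approximable (row_span UNIV (\<lambda>j. row j L))
    (\<lambda>x. cis (2 * pi * (\<theta> \<bullet> (of_int_vec (R (L *v of_int_vec x)) - L *v of_int_vec x))))"
proof -
  let ?v = "\<lambda>t. (\<chi> j. t j) :: real ^ 'n"
  let ?X = "product_topology (\<lambda>_. euclideanreal) (UNIV :: 'n set)"
  have X: "?X = euclidean" by (rule euclidean_product_topology)
  define \<Omega> where "\<Omega> = R -` {0}"
  define K where "K = {t. ?v t \<in> frontier \<Omega>}"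
  define E where "E u = cis (2 * pi * (\<theta> \<bullet> (of_int_vec (R u) - u)))" for u
  have R_add: "R (u + of_int_vec z) = R u + z" for u z using R by (simp add: quantizer_def)
  have of_int_vec_add: "of_int_vec (y + z) = of_int_vec y + of_int_vec z" for y z :: "int ^ 'n"
    by (simp add: of_int_vec_def vec_eq_iff)
  have \<Omega>: "bounded \<Omega>" "frontier \<Omega> \<in> null_sets lborel"
    using R by (auto simp: quantizer_def jordan_measurable_def \<Omega>_def)
  have v_cont: "continuous_on UNIV ?v"
    by (intro continuous_on_vec_lambda continuous_on_product_coordinates)
  have "K = vec_nth ` frontier \<Omega>" by (auto simp: K_def image_iff fun_eq_iff vec_lambda_eta intro!: bexI[of _ "?v _"])
  moreover have "compact (vec_nth ` frontier \<Omega>)"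
    by (intro compact_continuous_image continuous_on_coordinatewise_then_product
        continuous_intros compact_frontier_bounded \<Omega>)
  ultimately have K_comp: "compactin ?X K" by (simp add: X)
  have "frontier \<Omega> \<in> null_sets (distr (PiM UNIV (\<lambda>_. lborel)) borel ?v)"
    using \<Omega>(2) by (simp only: distr_vec_lambda_lborel)
  then have K_null: "K \<in> null_sets (PiM UNIV (\<lambda>_. lborel))"
    by (subst (asm) null_sets_distr_iff[OF measurable_vec_lambda_lborel])
       (simp add: K_def vimage_def space_PiM)
  have "trig_approximable (row_span UNIV (\<lambda>j. row j L)) (\<lambda>x. E (?v (lattice_orbit UNIV (\<lambda>j. row j L) x)))"
  proof (rule trig_approximable_orbit[OF _ L K_comp K_null])
    fix s t :: "'n \<Rightarrow> real" assume "torus_map UNIV s = torus_map UNIV t"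
    then have "?v s - ?v t \<in> int_vecs" by (simp add: torus_map_eq_iff int_vecs_iff)
    then obtain z where "?v s - ?v t = of_int_vec z" by (auto simp: int_vecs_def)
    then have z: "?v s = ?v t + of_int_vec z" by (simp add: algebra_simps)
    show "E (?v s) = E (?v t)" unfolding E_def z R_add of_int_vec_add by simp
  next
    fix t :: "'n \<Rightarrow> real" and \<epsilon> :: real
    assume t: "torus_map UNIV t \<notin> torus_map UNIV ` K" and "\<epsilon> > 0"
    define z where "z = R (?v t)"
    \<comment> \<open>\<open>D\<close> is \<open>E\<close> with \<open>R\<close> frozen at its value
      at \<open>t\<close>, hence continuous; the two agree on the cell translated by
      \<open>z\<close>.\<close>
    define D where "D u = cis (2 * pi * (\<theta> \<bullet> (of_int_vec z - u)))" for u
    define W where "W = (\<lambda>s. ?v s - of_int_vec z) -` interior \<Omega> \<inter> {s. cmod (D (?v s) - D (?v t)) < \<epsilon>}"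
    have R_z: "R u = z" if "u - of_int_vec z \<in> \<Omega>" for u
      using R_add[of "u - of_int_vec z" z] that by (simp add: \<Omega>_def)
    have "R (?v t - of_int_vec z) = 0" using R_add[of "?v t - of_int_vec z" z] by (simp add: z_def)
    then have "?v t - of_int_vec z \<in> \<Omega>" by (simp add: \<Omega>_def)
    \<comment> \<open>Otherwise \<open>t\<close> would lie over \<open>K\<close>, since subtracting
      the integer vector \<open>z\<close> does not change its image on the torus.\<close>
    moreover have "?v t - of_int_vec z \<notin> frontier \<Omega>"
    proof
      assume "?v t - of_int_vec z \<in> frontier \<Omega>"
      moreover have "?v (\<lambda>j. t j - of_int (z $ j)) = ?v t - of_int_vec z"
        by (simp add: vec_eq_iff of_int_vec_def)
      ultimately have "(\<lambda>j. t j - of_int (z $ j)) \<in> K" by (simp add: K_def)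
      moreover have "torus_map UNIV t = torus_map UNIV (\<lambda>j. t j - of_int (z $ j))"
        by (simp add: torus_map_eq_iff)
      ultimately show False using t by blast
    qed
    ultimately have "?v t - of_int_vec z \<in> interior \<Omega>"
      using closure_subset[of \<Omega>] by (auto simp: frontier_def)
    then have "t \<in> W" using \<open>\<epsilon> > 0\<close> by (simp add: W_def)
    moreover have "open W"
      unfolding W_def D_def
      by (intro open_Int open_vimage open_interior open_Collect_less continuous_intros v_cont)
    moreover have "cmod (E (?v s) - E (?v t)) < \<epsilon>" if "s \<in> W" for s
    proof -
      have "R (?v s) = z" using that R_z interior_subset[of \<Omega>] by (auto simp: W_def)
      then show ?thesis using that by (simp add: W_def E_def D_def z_def)
    qed
    ultimately show "\<exists>W. openin ?X W \<and> t \<in> W \<and> (\<forall>s\<in>W. cmod (E (?v s) - E (?v t)) < \<epsilon>)"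
      unfolding X by (intro exI[of _ W]) simp
  qed (auto simp: E_def)
  moreover have "?v (lattice_orbit UNIV (\<lambda>j. row j L) x) = L *v of_int_vec x" for x
    by (simp add: vec_eq_iff lattice_orbit_def matrix_vector_mul_component row_def)
  ultimately show ?thesis by (simp add: E_def)
qed

section \<open>Stacked powers and the transition operator\<close>

lemma sum_int_basis: "(\<Sum>i\<in>UNIV. real_of_int (z $ i) *\<^sub>R row i (mat 1 :: real ^ 'n ^ 'n)) = of_int_vec z"
  by (simp add: vec_eq_iff of_int_vec_def row_def mat_def if_distrib cong: if_cong)

text \<open>An integer combination of rows that equals an integer vector \<open>z\<close> is a
  rational relation among these rows and the rows of the identity, the latter with coefficients
  \<open>- z\<close>.\<close>

lemma stacked_powers_independent:
  fixes L :: "real ^ 'n ^ 'n" and k :: "int \<times> 'n \<Rightarrow> int"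
  assumes L: "iteratively_nonresonant L" and J: "finite J" "J \<subseteq> rows_all"
    and sum: "(\<Sum>j\<in>J. of_int (k j) *\<^sub>R stacked_powers L j) \<in> int_vecs" and j: "j \<in> J"
  shows "k j = 0"
proof -
  obtain \<sigma> where \<sigma>: "bij_betw \<sigma> {..<card J} J"
    using ex_bij_betw_nat_finite[OF J(1)] by (auto simp: atLeast0LessThan)
  \<comment> \<open>\<open>iteratively_nonresonant\<close> speaks of submatrices with at least one
    row; \<open>j\<close> shows that \<open>J\<close> is nonempty.\<close>
  have "card J \<ge> 1" using J(1) j by (metis One_nat_def Suc_leI card_gt_0_iff empty_iff)
  moreover have "row_selection rows_all (card J) \<sigma>"
    using \<sigma> J(2) by (auto simp: row_selection_def bij_betw_def)
  ultimately have nr: "nonresonant (card J) (stacked_powers L \<circ> \<sigma>)"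
    using L by (simp add: iteratively_nonresonant_def)
  obtain z where z: "(\<Sum>j\<in>J. of_int (k j) *\<^sub>R stacked_powers L j) = of_int_vec z"
    using sum by (auto simp: int_vecs_def)
  define c :: "'n + nat \<Rightarrow> rat" where "c = case_sum (\<lambda>i. - of_int (z $ i)) (\<lambda>i. of_int (k (\<sigma> i)))"
  have "(\<Sum>i\<in>(UNIV :: 'n set) <+> {..<card J}. real_of_rat (c i) *\<^sub>R
      case_sum (\<lambda>j. row j (mat 1)) (stacked_powers L \<circ> \<sigma>) i) =
    - (\<Sum>i\<in>UNIV. real_of_int (z $ i) *\<^sub>R row i (mat 1)) +
    (\<Sum>i<card J. of_int (k (\<sigma> i)) *\<^sub>R stacked_powers L (\<sigma> i))"
    by (simp add: sum.Plus c_def o_def of_rat_minus sum_negf)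
  also have "(\<Sum>i<card J. of_int (k (\<sigma> i)) *\<^sub>R stacked_powers L (\<sigma> i)) = of_int_vec z"
    using sum.reindex_bij_betw[OF \<sigma>, of "\<lambda>j. of_int (k j) *\<^sub>R stacked_powers L j"] z by simp
  finally have "\<forall>i\<in>(UNIV :: 'n set) <+> {..<card J}. c i = 0"
    using nr unfolding nonresonant_def rat_lin_indep_def sum_int_basis by simp
  moreover obtain i where "i < card J" "j = \<sigma> i" using \<sigma> j by (auto simp: bij_betw_def)
  ultimately have "c (Inr i) = 0" by blast
  then show ?thesis using \<open>j = \<sigma> i\<close> by (simp add: c_def)
qed

definition stacked_span :: "real ^ 'n ^ 'n \<Rightarrow> (int \<times> 'n) set \<Rightarrow> (real ^ 'n) set" where
  "stacked_span L K = {\<Sum>j\<in>J. of_int (k j) *\<^sub>R stacked_powers L j | J (k :: int \<times> 'n \<Rightarrow> int). finite J \<and> J \<subseteq> K}"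

lemma row_span_selection:
  assumes inj: "inj_on \<sigma> I" and I: "finite I" "\<sigma> ` I \<subseteq> K"
  shows "row_span I (stacked_powers L \<circ> \<sigma>) \<subseteq> stacked_span L K"
proof
  fix \<theta> assume "\<theta> \<in> row_span I (stacked_powers L \<circ> \<sigma>)"
  then obtain k :: "_ \<Rightarrow> int" where "\<theta> = (\<Sum>i\<in>I. of_int (k i) *\<^sub>R stacked_powers L (\<sigma> i))"
    by (auto simp: row_span_def)
  also have "\<dots> = (\<Sum>j\<in>\<sigma> ` I. of_int (k (inv_into I \<sigma> j)) *\<^sub>R stacked_powers L j)"
    using inj by (simp add: sum.reindex)
  finally show "\<theta> \<in> stacked_span L K"
    unfolding stacked_span_def mem_Collect_eq using I
    by (intro exI[of _ "\<sigma> ` I"] exI[of _ "\<lambda>j. k (inv_into I \<sigma> j)"]) simp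
qed

lemma integrally_nonresonant_selection:
  assumes L: "iteratively_nonresonant L" and inj: "inj_on \<sigma> I" and I: "finite I" "\<sigma> ` I \<subseteq> rows_all"
  shows "integrally_nonresonant I (stacked_powers L \<circ> \<sigma>)"
  unfolding integrally_nonresonant_def
proof (intro allI impI ballI)
  fix k :: "_ \<Rightarrow> int" and i
  assume "(\<Sum>i\<in>I. of_int (k i) *\<^sub>R (stacked_powers L \<circ> \<sigma>) i) \<in> int_vecs" "i \<in> I"
  moreover have "(\<Sum>j\<in>\<sigma> ` I. of_int (k (inv_into I \<sigma> j)) *\<^sub>R stacked_powers L j) =
      (\<Sum>i\<in>I. of_int (k i) *\<^sub>R (stacked_powers L \<circ> \<sigma>) i)"
    using inj by (simp add: sum.reindex)
  ultimately have "k (inv_into I \<sigma> (\<sigma> i)) = 0"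
    using stacked_powers_independent[OF L _ I(2), of "\<lambda>j. k (inv_into I \<sigma> j)" "\<sigma> i"] I(1) by simp
  then show "k i = 0" using inj \<open>i \<in> I\<close> by simp
qed

text \<open>With disjoint index sets, an integral sum of two frequencies is a single relation over
  the union of their supports; all coefficients vanish, and both frequencies are even 0.\<close>

lemma char_independent_stacked_span:
  assumes L: "iteratively_nonresonant L" and K: "K \<subseteq> rows_all" "K' \<subseteq> rows_all" "K \<inter> K' = {}"
  shows "char_independent (stacked_span L K) (stacked_span L K')"
  unfolding char_independent_def
proof (intro ballI impI)
  fix \<theta> \<eta> assume \<theta>: "\<theta> \<in> stacked_span L K" and \<eta>: "\<eta> \<in> stacked_span L K'" and int: "\<theta> + \<eta> \<in> int_vecs"
  obtain J k where J: "\<theta> = (\<Sum>j\<in>J. of_int (k j) *\<^sub>R stacked_powers L j)" "finite J" "J \<subseteq> K"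
    using \<theta> unfolding stacked_span_def by blast
  obtain J' k' where J': "\<eta> = (\<Sum>j\<in>J'. of_int (k' j) *\<^sub>R stacked_powers L j)" "finite J'" "J' \<subseteq> K'"
    using \<eta> unfolding stacked_span_def by blast
  have dis: "J \<inter> J' = {}" using J J' K by blast
  define l where "l j = (if j \<in> J then k j else k' j)" for j
  have l': "j \<in> J' \<Longrightarrow> l j = k' j" for j using dis by (auto simp: l_def)
  have sum: "(\<Sum>j\<in>J \<union> J'. of_int (l j) *\<^sub>R stacked_powers L j) = \<theta> + \<eta>"
  proof -
    have "(\<Sum>j\<in>J'. of_int (l j) *\<^sub>R stacked_powers L j) = \<eta>" unfolding J'(1) by (simp add: l')
    moreover have "(\<Sum>j\<in>J. of_int (l j) *\<^sub>R stacked_powers L j) = \<theta>" unfolding J(1) by (simp add: l_def)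
    ultimately show ?thesis by (simp add: sum.union_disjoint J(2) J'(2) dis)
  qed
  have sub: "J \<union> J' \<subseteq> rows_all" using J(3) J'(3) K by blast
  have l: "l j = 0" if "j \<in> J \<union> J'" for j
    by (rule stacked_powers_independent[OF L _ sub _ that]) (simp_all add: sum int J(2) J'(2))
  have "k j = 0" if "j \<in> J" for j using l[of j] that by (simp add: l_def)
  then have "\<theta> = 0" unfolding J(1) by simp
  moreover have "k' j = 0" if "j \<in> J'" for j using l[of j] l'[OF that] that by simp
  then have "\<eta> = 0" unfolding J'(1) by simp
  ultimately show "\<theta> \<in> int_vecs \<and> \<eta> \<in> int_vecs" by (simp add: int_vecs_iff)
qed

lemma Q_inf_trig_approximable:
  assumes L: "iteratively_nonresonant L" and K: "K \<subseteq> rows_all" and A: "A \<in> Q_inf K (stacked_powers L)"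
  shows "trig_approximable (stacked_span L K) (\<lambda>x. of_bool (x \<in> A))"
proof -
  obtain m \<sigma> where \<sigma>: "row_selection K m \<sigma>" and A: "A \<in> Q_fin m (stacked_powers L \<circ> \<sigma>)"
    using A by (auto simp: Q_inf_def)
  then have inj: "inj_on \<sigma> {..<m}" and im: "\<sigma> ` {..<m} \<subseteq> K" by (auto simp: row_selection_def)
  have "integrally_nonresonant {..<m} (stacked_powers L \<circ> \<sigma>)"
    using integrally_nonresonant_selection[OF L inj] im K by auto
  from quasiperiodic_trig_approximable[OF this A] show ?thesis
    by (rule trig_approximable_mono) (rule row_span_selection[OF inj _ im], simp)
qed

lemma mat_powi_mult:
  assumes "0 \<le> k" shows "mat_powi L k ** L = mat_powi L (k + 1)"
proof -
  \<comment> \<open>\<open>mat_powi\<close> iterates multiplication by \<open>L\<close> on the left,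
    whereas the rows get multiplied by \<open>L\<close> on the right.\<close>
  have "(((**) L) ^^ n) (mat 1) ** L = (((**) L) ^^ Suc n) (mat 1)" for n
    by (induct n) (simp_all add: matrix_mul_assoc[symmetric])
  then show ?thesis using assms by (simp add: mat_powi_def nat_add_distrib)
qed

lemma row_vector_matrix_mult: "row j (A ** B) = row j A v* B" for A :: "real ^ 'n ^ 'm" and B :: "real ^ 'k ^ 'n"
  by (simp add: vec_eq_iff row_def vector_matrix_mult_def matrix_matrix_mult_def mult.commute)

lemma sum_vector_matrix_mult:
  fixes L :: "real ^ 'n ^ 'm"
  shows "(\<Sum>j\<in>J. c j *\<^sub>R v j) v* L = (\<Sum>j\<in>J. c j *\<^sub>R (v j v* L))"
  by (induct J rule: infinite_finite_induct) (simp_all add: vector_matrix_left_distrib scaleR_vector_matrix_assoc)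

text \<open>
  Here \<open>\<theta> \<bullet> T x = (\<theta> L) \<bullet> x + \<theta> \<bullet> (R (L x) - L x)\<close>. The frequencies of the first summand come from the
  blocks \<open>L\<^sup>k\<close> with \<open>k \<ge> 2\<close>, those of the second, a function of \<open>L x\<close> modulo the lattice, from the
  block \<open>L\<close> alone.
\<close>

lemma transition_has_mean_char:
  fixes R :: "real ^ 'n \<Rightarrow> int ^ 'n" and L :: "real ^ 'n ^ 'n"
  assumes R: "quantizer R" and L: "iteratively_nonresonant L" and \<theta>: "\<theta> \<in> stacked_span L rows_forward"
  shows "has_mean (\<lambda>x. lattice_char \<theta> (transition R L x)) (if \<theta> \<in> int_vecs then 1 else 0)"
proof (cases "\<theta> \<in> int_vecs")
  case True
  then show ?thesis using has_mean_const[of 1] by (simp add: lattice_char_int_vecs)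
next
  case False
  define K1 :: "(int \<times> 'n) set" where "K1 = {(k, j). k = 1}"
  define K2 :: "(int \<times> 'n) set" where "K2 = {(k, j). 2 \<le> k}"
  \<comment> \<open>The effect of right multiplication by \<open>L\<close> on the indices of forward
    rows.\<close>
  define shift :: "int \<times> 'n \<Rightarrow> int \<times> 'n" where "shift = (\<lambda>(k, j). (k + 1, j))"
  define \<phi> where "\<phi> x = cis (2 * pi * (\<theta> \<bullet> (of_int_vec (R (L *v of_int_vec x)) - L *v of_int_vec x)))" for x
  obtain J k where J: "\<theta> = (\<Sum>j\<in>J. of_int (k j) *\<^sub>R stacked_powers L j)" "finite J" "J \<subseteq> rows_forward"
    using \<theta> unfolding stacked_span_def by blast
  have inj: "inj_on shift J" by (auto simp: shift_def inj_on_def)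
  have im: "shift ` J \<subseteq> K2" using J(3) by (auto simp: shift_def K2_def rows_forward_def)
  have sp: "stacked_powers L j v* L = (stacked_powers L \<circ> shift) j" if "j \<in> J" for j
    using that J(3)
    by (auto simp: stacked_powers_def shift_def rows_forward_def mat_powi_mult[symmetric] row_vector_matrix_mult)
  have \<theta>L: "\<theta> v* L = (\<Sum>j\<in>J. of_int (k j) *\<^sub>R (stacked_powers L \<circ> shift) j)"
    unfolding J(1) sum_vector_matrix_mult using sp by simp
  have "\<theta> v* L \<in> row_span J (stacked_powers L \<circ> shift)" unfolding \<theta>L row_span_def by blast
  then have in2: "\<theta> v* L \<in> stacked_span L K2" using row_span_selection[OF inj J(2) im] by blast
  have "K2 \<subseteq> rows_all" "K1 \<subseteq> rows_all" by (auto simp: K1_def K2_def rows_all_def)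
  \<comment> \<open>Nonresonance of the shifted rows would make every \<open>k j\<close> vanish, so
    \<open>\<theta>\<close> would be 0 and thereby integral.\<close>
  have notin: "\<theta> v* L \<notin> int_vecs"
  proof
    assume "\<theta> v* L \<in> int_vecs"
    then have "\<forall>j\<in>J. k j = 0"
      using integrally_nonresonant_selection[OF L inj J(2)] im \<open>K2 \<subseteq> rows_all\<close>
      unfolding \<theta>L integrally_nonresonant_def by blast
    then have "\<theta> = 0" unfolding J(1) by simp
    then show False using False by (simp add: int_vecs_iff)
  qed
  have first: "stacked_powers L \<circ> Pair 1 = (\<lambda>j. row j L)"
    by (simp add: fun_eq_iff stacked_powers_def mat_powi_def)
  have "range (Pair 1) \<subseteq> K1" by (auto simp: K1_def)
  then have "integrally_nonresonant UNIV (stacked_powers L \<circ> Pair 1)"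
    using integrally_nonresonant_selection[OF L, of "Pair 1" UNIV] \<open>K1 \<subseteq> rows_all\<close> by (auto simp: inj_on_def)
  then have "trig_approximable (row_span UNIV (stacked_powers L \<circ> Pair 1)) \<phi>"
    unfolding first \<phi>_def using quantization_error_trig_approximable[OF R] by blast
  then have \<phi>: "trig_approximable (stacked_span L K1) \<phi>"
    by (rule trig_approximable_mono) (rule row_span_selection, use \<open>range (Pair 1) \<subseteq> K1\<close> in \<open>auto simp: inj_on_def\<close>)
  then obtain b where b: "has_mean \<phi> b" using trig_approximable_has_mean by blast
  have ind: "char_independent (stacked_span L K2) (stacked_span L K1)"
    by (rule char_independent_stacked_span[OF L]) (auto simp: K1_def K2_def rows_all_def)
  \<comment> \<open>Because this factor has mean 0, the unknown mean \<open>b\<close> of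
    \<open>\<phi>\<close> drops out of the product.\<close>
  have "has_mean (lattice_char (\<theta> v* L)) 0" using has_mean_lattice_char[of "\<theta> v* L"] notin by simp
  from trig_approximable_mult_has_mean[OF ind trig_approximable_lattice_char[OF in2] this \<phi> b]
  have "has_mean (\<lambda>x. lattice_char (\<theta> v* L) x * \<phi> x) 0" by (simp add: \<phi>_def)
  moreover have "lattice_char (\<theta> v* L) x * \<phi> x = lattice_char \<theta> (transition R L x)" for x
    by (simp add: lattice_char_def \<phi>_def cis_mult dot_lmul_matrix transition_def inner_diff_right algebra_simps)
  ultimately show ?thesis using False by simp
qed

text \<open>Averages of an indicator are real, hence so is \<open>c\<close>, and the limit of the
  densities determines it completely.\<close>

lemma has_mean_freq:
  assumes "has_mean (\<lambda>x. of_bool (x \<in> A)) c"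
  shows "freq_measurable A" "of_real (freq A) = c"
proof -
  have "(\<lambda>P. Im (avg (\<lambda>x. of_bool (x \<in> A)) P)) = (\<lambda>_. 0)"
    by (simp add: avg_def Im_divide_of_nat of_bool_def if_distrib[of Im] cong: if_cong)
  moreover have "((\<lambda>P. Im (avg (\<lambda>x. of_bool (x \<in> A)) P)) \<longlongrightarrow> Im c) box_filter"
    using assms unfolding has_mean_def by (intro tendsto_intros)
  ultimately have "Im c = 0" by (simp add: tendsto_const_iff)
  with freq_eqI[OF density_tendsto[OF assms]] show "freq_measurable A" "of_real (freq A) = c"
    by (simp_all add: complex_eq_iff)
qed

theorem theorem7:
  fixes R :: "real ^ 'n \<Rightarrow> int ^ 'n" and L :: "real ^ 'n ^ 'n"
  assumes "quantizer R"
    and "invertible L"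
    and "iteratively_nonresonant L"
  shows "(\<forall>A\<in>associated_algebra L. freq_measurable A) \<and>
    (\<forall>A\<in>backward_algebra L. \<forall>B\<in>forward_algebra L.
       freq_measurable (A \<inter> B) \<and> freq (A \<inter> B) = freq A * freq B) \<and>
    (\<forall>A\<in>forward_algebra L.
       freq_measurable (transition R L -` A) \<and> freq (transition R L -` A) = freq A)"
proof (intro conjI ballI)
  note R = assms(1) and L = assms(3)
  have bw: "rows_backward \<subseteq> rows_all" and fw: "rows_forward \<subseteq> rows_all"
    by (auto simp: rows_backward_def rows_forward_def rows_all_def)
  \<comment> \<open>Stated for a general row set \<open>K\<close>, so as to serve all three
    algebras.\<close>
  have mean: "has_mean (\<lambda>x. of_bool (x \<in> A)) (of_real (freq A))" "freq_measurable A"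
    if K: "K \<subseteq> rows_all" "A \<in> Q_inf K (stacked_powers L)" for K A
  proof -
    obtain a where a: "has_mean (\<lambda>x. of_bool (x \<in> A)) a"
      using trig_approximable_has_mean[OF Q_inf_trig_approximable[OF L K]] by blast
    then show "has_mean (\<lambda>x. of_bool (x \<in> A)) (of_real (freq A))" "freq_measurable A"
      by (simp_all add: has_mean_freq[OF a])
  qed
  show "freq_measurable A" if "A \<in> associated_algebra L" for A
    using that unfolding associated_algebra_def by (rule mean(2)[OF subset_refl])
  {
    fix A B assume A: "A \<in> backward_algebra L" and B: "B \<in> forward_algebra L"
    note A = A[unfolded backward_algebra_def] and B = B[unfolded forward_algebra_def]
    have "char_independent (stacked_span L rows_backward) (stacked_span L rows_forward)"
      by (rule char_independent_stacked_span[OF L bw fw]) (auto simp: rows_backward_def rows_forward_def)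
    from trig_approximable_mult_has_mean[OF this Q_inf_trig_approximable[OF L bw A] mean(1)[OF bw A]
        Q_inf_trig_approximable[OF L fw B] mean(1)[OF fw B]]
    have "has_mean (\<lambda>x. of_bool (x \<in> A \<inter> B)) (of_real (freq A) * of_real (freq B))"
      by (simp add: of_bool_conj)
    from has_mean_freq[OF this] show "freq_measurable (A \<inter> B)" "freq (A \<inter> B) = freq A * freq B"
      by (simp_all flip: of_real_mult)
  }
  fix A assume "A \<in> forward_algebra L"
  note A = this[unfolded forward_algebra_def]
  from trig_approximable_has_mean_compose[OF transition_has_mean_char[OF R L]
      Q_inf_trig_approximable[OF L fw A] mean(1)[OF fw A]]
  have "has_mean (\<lambda>x. of_bool (x \<in> transition R L -` A)) (of_real (freq A))" by simp
  from has_mean_freq[OF this]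
  show "freq_measurable (transition R L -` A)" "freq (transition R L -` A) = freq A" by simp_all
qed

end
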